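(* Let $\mathcal A:\mathbb R^{n_1\times n_2}\to\mathbb R^m$ be linear and suppose there is $\Delta>0$ such that $\|\mathbf H\|_*\ge\sqrt{m/\Delta}\,\|\mathbf H\|_F$ for all nonzero $\mathbf H\in\mathrm{Null}(\mathcal A)$. Let $\mathbf X^0\in\mathbb R^{n_1\times n_2}$ be arbitrary, $\alpha>\sigma_{r+1}(\mathbf X^0)$, $C_3:=\frac{\alpha+\sigma_1(\mathbf X^0)}{\alpha-\sigma_{r+1}(\mathbf X^0)}$, $C_4:=\frac{2\alpha}{\alpha-\sigma_{r+1}(\mathbf X^0)}$. If $m\ge4(1+C_3)^2r\Delta$, then the solution $\mathbf X^*$ of (N2) with $\mathbf b=\mathcal A(\mathbf X^0)$ satisfies $\|\mathbf X^*-\mathbf X^0\|_*\le4C_4\hat\sigma(\mathbf X^0)$, where $\hat\sigma(\mathbf X^0)=\sum_{i=r+1}^{\min\{n_1,n_2\}}\sigma_i(\mathbf X^0)$.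
   Context: Problem (N2) is $\min_{\mathbf X}\{\|\mathbf X\|_*+\frac{1}{2\alpha}\|\mathbf X\|_F^2:\ \mathcal A(\mathbf X)=\mathbf b\}$. $\sigma_i(\cdot)$ is the $i$-th largest singular value (zero if $i$ exceeds the rank); $\|\cdot\|_*$, $\|\cdot\|_F$ are nuclear and Frobenius norms. *)

theory Defs
  imports Complex_Main "Jordan_Normal_Form.Matrix"
begin

definition is_svd :: "real mat \<Rightarrow> real mat \<Rightarrow> real mat \<Rightarrow> real mat \<Rightarrow> bool" where
  "is_svd A U S V \<longleftrightarrow>
     (let n1 = dim_row A; n2 = dim_col A in
       U \<in> carrier_mat n1 n1 \<and> V \<in> carrier_mat n2 n2 \<and> S \<in> carrier_mat n1 n2 \<and>
       transpose_mat U * U = 1\<^sub>m n1 \<and> transpose_mat V * V = 1\<^sub>m n2 \<and>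
       (\<forall>i<n1. \<forall>j<n2. i \<noteq> j \<longrightarrow> S $$ (i,j) = 0) \<and>
       (\<forall>i<min n1 n2. 0 \<le> S $$ (i,i)) \<and>
       (\<forall>i j. i \<le> j \<longrightarrow> j < min n1 n2 \<longrightarrow> S $$ (j,j) \<le> S $$ (i,i)) \<and>
       A = U * S * transpose_mat V)"

(* sigma_i(A), 1-based: i-th largest singular value; zero for i = 0 or i > min n1 n2 *)
definition sing_val :: "real mat \<Rightarrow> nat \<Rightarrow> real" where
  "sing_val A i = (THE s. \<exists>U S V. is_svd A U S V \<and>
      s = (if 1 \<le> i \<and> i \<le> min (dim_row A) (dim_col A) then S $$ (i-1, i-1) else 0))"

definition nuc_norm :: "real mat \<Rightarrow> real" where
  "nuc_norm A = (\<Sum>i=1..min (dim_row A) (dim_col A). sing_val A i)"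

definition fro_norm :: "real mat \<Rightarrow> real" where
  "fro_norm A = sqrt (\<Sum>i<dim_row A. \<Sum>j<dim_col A. (A $$ (i,j))^2)"

definition lin_meas :: "nat \<Rightarrow> nat \<Rightarrow> nat \<Rightarrow> (real mat \<Rightarrow> real vec) \<Rightarrow> bool" where
  "lin_meas n1 n2 m \<A> \<longleftrightarrow>
     (\<forall>X\<in>carrier_mat n1 n2. \<A> X \<in> carrier_vec m) \<and>
     (\<forall>X\<in>carrier_mat n1 n2. \<forall>Y\<in>carrier_mat n1 n2. \<A> (X + Y) = \<A> X + \<A> Y) \<and>
     (\<forall>X\<in>carrier_mat n1 n2. \<forall>c. \<A> (c \<cdot>\<^sub>m X) = c \<cdot>\<^sub>v \<A> X)"

definition null_space :: "nat \<Rightarrow> nat \<Rightarrow> nat \<Rightarrow> (real mat \<Rightarrow> real vec) \<Rightarrow> real mat set" where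
  "null_space n1 n2 m \<A> = {H \<in> carrier_mat n1 n2. \<A> H = 0\<^sub>v m}"

definition N2_obj :: "real \<Rightarrow> real mat \<Rightarrow> real" where
  "N2_obj \<alpha> X = nuc_norm X + 1 / (2 * \<alpha>) * (fro_norm X)^2"

definition is_N2_solution :: "nat \<Rightarrow> nat \<Rightarrow> (real mat \<Rightarrow> real vec) \<Rightarrow> real vec \<Rightarrow> real \<Rightarrow> real mat \<Rightarrow> bool" where
  "is_N2_solution n1 n2 \<A> b \<alpha> X \<longleftrightarrow>
     X \<in> carrier_mat n1 n2 \<and> \<A> X = b \<and>
     (\<forall>Y\<in>carrier_mat n1 n2. \<A> Y = b \<longrightarrow> N2_obj \<alpha> X \<le> N2_obj \<alpha> Y)"

end

theory Submission
  imports Defs "Jordan_Normal_Form.Spectral_Radius" "HOL-Analysis.Convex"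
begin

unbundle no inner_syntax

text \<open>
  The nuclear norm is dual to the operator norm: \<open>nuc_norm A\<close> is the maximum of \<open>\<langle>A, W\<rangle>\<close> over
  contractions \<open>W\<close>. Orthogonal invariance reduces the theorem to the case that \<open>X0\<close> is its diagonal
  matrix \<open>S\<close> of singular values. Write the error as \<open>G = G1 + G2\<close>, with \<open>G2\<close> the block of
  indices \<open>i, j \<ge> r\<close>. Testing \<open>S + G\<close> against the identity on the leading block, completed by an
  optimal contraction for \<open>G2\<close>, bounds its nuclear norm from below, and the cross term \<open>\<langle>S, G\<rangle>\<close> is at
  least \<open>- \<sigma>\<^sub>1 \<parallel>G1\<parallel> - \<sigma>\<^bsub>r+1\<^esub> \<parallel>G2\<parallel>\<close> in nuclear norms. Optimality then gives
  \<open>\<parallel>G2\<parallel> \<le> C3 \<parallel>G1\<parallel> + C4 t\<close>, where \<open>t\<close> is the tail of singular values. Since \<open>G1\<close> lives on \<open>r\<close> rows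
  and \<open>r\<close> columns, \<open>\<parallel>G1\<parallel> \<le> sqrt (2 r) fro_norm G\<close>, and the null space property absorbs
  \<open>(1 + C3) \<parallel>G1\<parallel>\<close> into at most \<open>3/4\<close> of \<open>\<parallel>G\<parallel>\<close>.
\<close>

section \<open>Real symmetric eigenvectors and orthogonal completion\<close>

text \<open>A complex eigenvector \<open>x\<close> exists for any nonempty square matrix. Symmetry
  makes its eigenvalue \<open>k\<close> real, and then the real and imaginary parts of
  \<open>x\<close> both satisfy the eigenvector equation; one of them is nonzero and can be
  normalised.\<close>

lemma symmetric_real_eigenvector:
  fixes M :: "real mat"
  assumes M: "M \<in> carrier_mat n n" and sym: "transpose_mat M = M" and n: "n > 0"
  shows "\<exists>v c. v \<in> carrier_vec n \<and> v \<bullet> v = 1 \<and> M *\<^sub>v v = c \<cdot>\<^sub>v v"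
proof -
  let ?C = "map_mat complex_of_real M"
  have C: "?C \<in> carrier_mat n n" using M by simp
  obtain k where "eigenvalue ?C k"
    using spectrum_non_empty[OF C n] unfolding spectrum_def by auto
  then obtain x where x: "x \<in> carrier_vec n" "x \<noteq> 0\<^sub>v n" and ev: "?C *\<^sub>v x = k \<cdot>\<^sub>v x"
    using C unfolding eigenvalue_def eigenvector_def by auto
  define a where "a = map_vec Re x"
  define b where "b = map_vec Im x"
  have ab: "a \<in> carrier_vec n" "b \<in> carrier_vec n" using x by (auto simp: a_def b_def)
  have ent: "(\<Sum>j<n. complex_of_real (M $$ (i,j)) * x $ j) = k * x $ i" if "i < n" for i
    using arg_cong[OF ev, of "\<lambda>v. v $ i"] that x(1) M
    by (simp add: scalar_prod_def lessThan_atLeast0)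
  have Ma: "M *\<^sub>v a = Re k \<cdot>\<^sub>v a - Im k \<cdot>\<^sub>v b"
  proof (rule eq_vecI)
    fix i assume "i < dim_vec (Re k \<cdot>\<^sub>v a - Im k \<cdot>\<^sub>v b)"
    then have i: "i < n" using ab by simp
    show "(M *\<^sub>v a) $ i = (Re k \<cdot>\<^sub>v a - Im k \<cdot>\<^sub>v b) $ i"
      using arg_cong[OF ent[OF i], of Re] i x(1) M
      by (simp add: scalar_prod_def lessThan_atLeast0 a_def b_def)
  qed (use M ab in auto)
  have Mb: "M *\<^sub>v b = Im k \<cdot>\<^sub>v a + Re k \<cdot>\<^sub>v b"
  proof (rule eq_vecI)
    fix i assume "i < dim_vec (Im k \<cdot>\<^sub>v a + Re k \<cdot>\<^sub>v b)"
    then have i: "i < n" using ab by simp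
    show "(M *\<^sub>v b) $ i = (Im k \<cdot>\<^sub>v a + Re k \<cdot>\<^sub>v b) $ i"
      using arg_cong[OF ent[OF i], of Im] i x(1) M
      by (simp add: scalar_prod_def lessThan_atLeast0 a_def b_def algebra_simps)
  qed (use M ab in auto)
  \<comment> \<open>Evaluating both sides with \<open>Ma\<close> and \<open>Mb\<close>, the terms
    with \<open>Re k\<close> cancel and \<open>Im k * (a \<bullet> a + b \<bullet> b) = 0\<close>
    remains.\<close>
  have "b \<bullet> (M *\<^sub>v a) = (M *\<^sub>v b) \<bullet> a"
    using transpose_vec_mult_scalar[OF M ab] sym by simp
  moreover have "b \<bullet> (M *\<^sub>v a) = Re k * (b \<bullet> a) - Im k * (b \<bullet> b)"
    unfolding Ma using ab by (simp add: scalar_prod_minus_distrib[of _ n])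
  moreover have "(M *\<^sub>v b) \<bullet> a = Im k * (a \<bullet> a) + Re k * (b \<bullet> a)"
    unfolding Mb using ab by (simp add: add_scalar_prod_distrib[of _ n])
  ultimately have "Im k * (a \<bullet> a + b \<bullet> b) = 0" by (simp add: algebra_simps)
  moreover have pos: "v \<bullet> v > 0" if "v \<in> carrier_vec n" "v \<noteq> 0\<^sub>v n" for v :: "real vec"
    using conjugate_square_greater_0_vec[OF that(1)] that(2) by simp
  have nonneg: "v \<bullet> v \<ge> 0" for v :: "real vec"
    using conjugate_square_ge_0_vec[of v] by simp
  have nz: "a \<noteq> 0\<^sub>v n \<or> b \<noteq> 0\<^sub>v n"
  proof (rule ccontr)
    assume "\<not> ?thesis"
    then have ab0: "a = 0\<^sub>v n" "b = 0\<^sub>v n" by auto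
    have "x $ i = 0" if "i < n" for i
      using that x(1) arg_cong[OF ab0(1), of "\<lambda>v. v $ i"] arg_cong[OF ab0(2), of "\<lambda>v. v $ i"]
      by (simp add: a_def b_def complex_eq_iff)
    then have "x = 0\<^sub>v n" using x(1) by (intro eq_vecI) auto
    then show False using x(2) by simp
  qed
  then have "a \<bullet> a + b \<bullet> b > 0"
    using pos[of a] pos[of b] nonneg[of a] nonneg[of b] ab by (auto intro: add_pos_nonneg add_nonneg_pos)
  ultimately have "Im k = 0" by simp
  then have "M *\<^sub>v a = Re k \<cdot>\<^sub>v a" "M *\<^sub>v b = Re k \<cdot>\<^sub>v b"
    using Ma Mb ab by auto
  then obtain v where v: "v \<in> carrier_vec n" "v \<noteq> 0\<^sub>v n" "M *\<^sub>v v = Re k \<cdot>\<^sub>v v"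
    using nz ab by blast
  let ?t = "1 / sqrt (v \<bullet> v)"
  have "(?t \<cdot>\<^sub>v v) \<bullet> (?t \<cdot>\<^sub>v v) = 1"
    using v(1) pos[OF v(1,2)] by simp
  moreover have "M *\<^sub>v (?t \<cdot>\<^sub>v v) = Re k \<cdot>\<^sub>v (?t \<cdot>\<^sub>v v)"
    using v M by (simp add: mult_mat_vec smult_smult_assoc mult.commute)
  ultimately show ?thesis using v(1) by (intro exI[of _ "?t \<cdot>\<^sub>v v"] exI[of _ "Re k"]) auto
qed

text \<open>The Householder reflection swapping the first unit vector and \<open>v\<close>; for \<open>v\<close> itself the first
  unit vector, \<open>c = 1 / 0 = 0\<close> makes it the identity.\<close>

lemma orthogonal_mat_with_first_col:
  fixes v :: "real vec"
  assumes v: "v \<in> carrier_vec n" and n: "n > 0" and unit: "v \<bullet> v = 1"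
  shows "\<exists>Q \<in> carrier_mat n n. transpose_mat Q * Q = 1\<^sub>m n \<and> col Q 0 = v"
proof -
  define w where "w i = v $ i - (if i = 0 then 1 else 0)" for i
  define c where "c = 1 / (1 - v $ 0)"
  define Q where "Q = mat n n (\<lambda>(i,j). (if i = j then 1 else 0) - c * w i * w j)"
  have vv: "(\<Sum>i<n. v $ i * v $ i) = 1"
    using unit v by (simp add: scalar_prod_def lessThan_atLeast0)
  \<comment> \<open>For \<open>v $ 0 \<noteq> 1\<close> this identifies \<open>c\<close> as 2
    divided by the squared length of \<open>w\<close>, the Householder normalisation. For
    \<open>v $ 0 = 1\<close> it forces \<open>w\<close> to vanish.\<close>
  have ww: "(\<Sum>i<n. w i * w i) = 2 * (1 - v $ 0)"
  proof -
    have "(\<Sum>i<n. w i * w i) = (\<Sum>i<n. v $ i * v $ i - (if i = 0 then 2 * v $ 0 - 1 else 0))"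
      by (rule sum.cong) (auto simp: w_def algebra_simps)
    then show ?thesis using vv n by (simp add: sum_subtractf sum.delta)
  qed
  have w0: "w i = 0" if "v $ 0 = 1" "i < n" for i
  proof -
    have "(\<Sum>i<n. w i * w i) = 0" using ww that by simp
    then show ?thesis using that(2) by (subst (asm) sum_nonneg_eq_0_iff) auto
  qed
  have "transpose_mat Q * Q = 1\<^sub>m n"
  proof (rule eq_matI)
    fix i j assume "i < dim_row (1\<^sub>m n :: real mat)" "j < dim_col (1\<^sub>m n :: real mat)"
    then have ij: "i < n" "j < n" by auto
    have "(transpose_mat Q * Q) $$ (i,j)
        = (\<Sum>k<n. ((if k = i then 1 else 0) - c * w k * w i) * ((if k = j then 1 else 0) - c * w k * w j))"
      using ij by (simp add: Q_def scalar_prod_def lessThan_atLeast0)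
    also have "\<dots> = (\<Sum>k<n. (if k = i then (if i = j then 1 else 0) - c * w i * w j else 0)
        - (if k = j then c * w i * w j else 0) + c^2 * w i * w j * (w k * w k))"
      by (rule sum.cong) (auto simp: algebra_simps power2_eq_square)
    also have "\<dots> = (if i = j then 1 else 0) - 2 * c * w i * w j + c^2 * w i * w j * (2 * (1 - v $ 0))"
      using ij by (simp add: sum.distrib sum_subtractf sum.delta sum_distrib_left[symmetric] ww)
    also have "\<dots> = (if i = j then 1 else 0)"
    proof (cases "v $ 0 = 1")
      case True
      then show ?thesis using w0 ij by simp
    next
      case False
      then have "c * (1 - v $ 0) = 1" by (simp add: c_def)
      moreover have "c^2 * w i * w j * (2 * (1 - v $ 0)) = 2 * c * w i * w j * (c * (1 - v $ 0))"
        by (simp add: power2_eq_square algebra_simps)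
      ultimately have "c^2 * w i * w j * (2 * (1 - v $ 0)) = 2 * c * w i * w j" by simp
      then show ?thesis by simp
    qed
    finally show "(transpose_mat Q * Q) $$ (i,j) = 1\<^sub>m n $$ (i,j)" using ij by simp
  qed (auto simp: Q_def)
  moreover have "col Q 0 = v"
  proof (rule eq_vecI)
    fix i assume "i < dim_vec v"
    then have i: "i < n" using v by simp
    show "col Q 0 $ i = v $ i"
    proof (cases "v $ 0 = 1")
      case True
      then show ?thesis using w0[OF True i] i n by (auto simp: Q_def w_def)
    next
      case False
      then have "c * (1 - v $ 0) = 1" by (simp add: c_def)
      moreover have "c * w i * w 0 = - w i * (c * (1 - v $ 0))"
        by (simp add: w_def algebra_simps)
      ultimately have "c * w i * w 0 = - w i" by simp
      then show ?thesis using i n by (simp add: Q_def w_def)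
    qed
  qed (use v in \<open>auto simp: Q_def\<close>)
  ultimately show ?thesis by (intro bexI[of _ Q]) (auto simp: Q_def)
qed

section \<open>Existence of singular value decompositions\<close>

text \<open>A singular value decomposition without the ordering of the diagonal.\<close>

definition diag_decomp :: "real mat \<Rightarrow> real mat \<Rightarrow> real mat \<Rightarrow> real mat \<Rightarrow> bool" where
  "diag_decomp A U S V \<longleftrightarrow>
     (let n1 = dim_row A; n2 = dim_col A in
       U \<in> carrier_mat n1 n1 \<and> V \<in> carrier_mat n2 n2 \<and> S \<in> carrier_mat n1 n2 \<and>
       transpose_mat U * U = 1\<^sub>m n1 \<and> transpose_mat V * V = 1\<^sub>m n2 \<and>
       (\<forall>i<n1. \<forall>j<n2. i \<noteq> j \<longrightarrow> S $$ (i,j) = 0) \<and>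
       (\<forall>i<min n1 n2. 0 \<le> S $$ (i,i)) \<and>
       A = U * S * transpose_mat V)"

lemma orthogonal_mat_comm:
  fixes U :: "real mat"
  assumes "U \<in> carrier_mat n n" "transpose_mat U * U = 1\<^sub>m n"
  shows "U * transpose_mat U = 1\<^sub>m n"
  using mat_mult_left_right_inverse[OF _ assms(1) assms(2)] assms(1) by simp

text \<open>The eigenvalue \<open>c\<close> equals the squared length of
  \<open>A *\<^sub>v v\<close>, so it is positive; \<open>s\<close> is its square root and
  \<open>u\<close> is \<open>A *\<^sub>v v\<close> normalised.\<close>

lemma singular_pair_of_nonzero_eigenvalue:
  fixes A :: "real mat"
  assumes A: "A \<in> carrier_mat n1 n2" and v: "v \<in> carrier_vec n2" "v \<bullet> v = 1"
    and ev: "(transpose_mat A * A) *\<^sub>v v = c \<cdot>\<^sub>v v" and c: "c \<noteq> 0"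
  shows "\<exists>u s. u \<in> carrier_vec n1 \<and> u \<bullet> u = 1 \<and> s \<ge> 0 \<and> A *\<^sub>v v = s \<cdot>\<^sub>v u \<and> transpose_mat A *\<^sub>v u = s \<cdot>\<^sub>v v"
proof -
  have At: "transpose_mat A \<in> carrier_mat n2 n1" using A by simp
  have Av: "A *\<^sub>v v \<in> carrier_vec n1" using A v by simp
  have ev': "transpose_mat A *\<^sub>v (A *\<^sub>v v) = c \<cdot>\<^sub>v v"
    using ev assoc_mult_mat_vec[OF At A v(1)] by simp
  have norm: "(A *\<^sub>v v) \<bullet> (A *\<^sub>v v) = c"
    using transpose_vec_mult_scalar[OF A v(1) Av] ev' v by simp
  then have "c \<ge> 0" using conjugate_square_ge_0_vec[of "A *\<^sub>v v"] by simp
  then have cpos: "c > 0" using c by simp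
  define s where "s = sqrt c"
  have s: "s > 0" "s * s = c" using cpos by (auto simp: s_def)
  define u where "u = (1 / s) \<cdot>\<^sub>v (A *\<^sub>v v)"
  have "u \<in> carrier_vec n1" using Av by (simp add: u_def)
  moreover have "u \<bullet> u = 1" using Av norm s c by (simp add: u_def field_simps)
  moreover have "A *\<^sub>v v = s \<cdot>\<^sub>v u" using s by (simp add: u_def smult_smult_assoc)
  moreover have "transpose_mat A *\<^sub>v u = s \<cdot>\<^sub>v v"
  proof -
    have "transpose_mat A *\<^sub>v u = (1 / s) \<cdot>\<^sub>v (c \<cdot>\<^sub>v v)"
      unfolding u_def using mult_mat_vec[OF At Av] ev' by simp
    also have "\<dots> = s \<cdot>\<^sub>v v" using s by (auto simp: smult_smult_assoc field_simps)
    finally show ?thesis .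
  qed
  ultimately show ?thesis using s(1) by (intro exI[of _ u] exI[of _ s]) auto
qed

text \<open>A nonzero eigenvalue of either Gram matrix yields a pair. If the eigenvalues found for
  both are zero, the eigenvectors lie in the kernels of \<open>A\<close> and of its transpose, and
  together they form a pair with \<open>s = 0\<close>.\<close>

lemma singular_pair_exists:
  fixes A :: "real mat"
  assumes A: "A \<in> carrier_mat n1 n2" and n: "n1 > 0" "n2 > 0"
  shows "\<exists>u v s. u \<in> carrier_vec n1 \<and> v \<in> carrier_vec n2 \<and> u \<bullet> u = 1 \<and> v \<bullet> v = 1 \<and> s \<ge> 0 \<and>
    A *\<^sub>v v = s \<cdot>\<^sub>v u \<and> transpose_mat A *\<^sub>v u = s \<cdot>\<^sub>v v"
proof -
  have At: "transpose_mat A \<in> carrier_mat n2 n1" using A by simp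
  have eig: "\<exists>v c. v \<in> carrier_vec m2 \<and> v \<bullet> v = 1 \<and> (transpose_mat B * B) *\<^sub>v v = c \<cdot>\<^sub>v v"
    if "B \<in> carrier_mat m1 m2" "m2 > 0" for B :: "real mat" and m1 m2
    using that by (intro symmetric_real_eigenvector) (auto simp: transpose_mult[of _ m2 m1 _ m2])
  have ker: "B *\<^sub>v v = 0\<^sub>v m1"
    if B: "B \<in> carrier_mat m1 m2" and v: "v \<in> carrier_vec m2" and ev: "(transpose_mat B * B) *\<^sub>v v = 0 \<cdot>\<^sub>v v"
    for B :: "real mat" and v m1 m2
  proof -
    have Bv: "B *\<^sub>v v \<in> carrier_vec m1" using B v by simp
    have "transpose_mat B *\<^sub>v (B *\<^sub>v v) = 0\<^sub>v m2"
      using ev v assoc_mult_mat_vec[of "transpose_mat B" m2 m1 B m2 v] B by auto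
    then have "(B *\<^sub>v v) \<bullet> (B *\<^sub>v v) = 0"
      using transpose_vec_mult_scalar[OF B v Bv] v by simp
    then show ?thesis using conjugate_square_eq_0_vec[OF Bv] by simp
  qed
  obtain v c where v: "v \<in> carrier_vec n2" "v \<bullet> v = 1" "(transpose_mat A * A) *\<^sub>v v = c \<cdot>\<^sub>v v"
    using eig[OF A n(2)] by auto
  obtain u d where u: "u \<in> carrier_vec n1" "u \<bullet> u = 1" "(A * transpose_mat A) *\<^sub>v u = d \<cdot>\<^sub>v u"
    using eig[OF At n(1)] by auto
  consider "c \<noteq> 0" | "d \<noteq> 0" | "c = 0" "d = 0" by blast
  then show ?thesis
  proof cases
    case 1
    then show ?thesis using singular_pair_of_nonzero_eigenvalue[OF A v] v by blast
  next
    case 2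
    then show ?thesis using singular_pair_of_nonzero_eigenvalue[OF At u(1,2), of d] u by auto
  next
    case 3
    have "A *\<^sub>v v = 0\<^sub>v n1" using ker[OF A v(1)] v(3) 3 by simp
    moreover have "transpose_mat A *\<^sub>v u = 0\<^sub>v n2" using ker[OF At u(1)] u(3) 3 by simp
    ultimately show ?thesis using u v
      by (intro exI[of _ u] exI[of _ v] exI[of _ 0]) auto
  qed
qed

lemma diag_decomp_trivial:
  fixes A :: "real mat"
  assumes "dim_row A = 0 \<or> dim_col A = 0"
  shows "diag_decomp A (1\<^sub>m (dim_row A)) A (1\<^sub>m (dim_col A))"
proof -
  have "1\<^sub>m (dim_row A) * A * transpose_mat (1\<^sub>m (dim_col A)) = A"
    using left_mult_one_mat'[of A] right_mult_one_mat'[of A] by simp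
  then show ?thesis using assms unfolding diag_decomp_def Let_def by auto
qed

lemma orthogonal_sandwich_recover:
  fixes A :: "real mat"
  assumes A: "A \<in> carrier_mat n1 n2" and U: "U \<in> carrier_mat n1 n1" "transpose_mat U * U = 1\<^sub>m n1"
    and V: "V \<in> carrier_mat n2 n2" "transpose_mat V * V = 1\<^sub>m n2"
  shows "U * (transpose_mat U * A * V) * transpose_mat V = A"
proof -
  have "U * (transpose_mat U * A * V) * transpose_mat V
      = (U * transpose_mat U) * A * (V * transpose_mat V)"
    using A U(1) V(1) by (simp add: assoc_mult_mat[of _ n1 n1 _ n1 _ n2] assoc_mult_mat[of _ n1 n1 _ n2 _ n2] 
       assoc_mult_mat[of _ n1 n2 _ n2 _ n2])
  then show ?thesis using A orthogonal_mat_comm[OF U] orthogonal_mat_comm[OF V] by simp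
qed

text \<open>The diagonal factor \<open>S\<close> is carried over unchanged. This serves the
  induction for existence and later the orthogonal invariance of the nuclear norm.\<close>

lemma diag_decomp_orthogonal_change:
  fixes A :: "real mat"
  assumes A: "A \<in> carrier_mat n1 n2" and U: "U \<in> carrier_mat n1 n1" "transpose_mat U * U = 1\<^sub>m n1"
    and V: "V \<in> carrier_mat n2 n2" "transpose_mat V * V = 1\<^sub>m n2"
    and B: "diag_decomp A P S Q"
  shows "diag_decomp (U * A * transpose_mat V) (U * P) S (V * Q)"
proof -
  have P: "P \<in> carrier_mat n1 n1" "transpose_mat P * P = 1\<^sub>m n1"
    and Q: "Q \<in> carrier_mat n2 n2" "transpose_mat Q * Q = 1\<^sub>m n2" and S: "S \<in> carrier_mat n1 n2"
    and Aeq: "A = P * S * transpose_mat Q"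
    and diag: "\<forall>i<n1. \<forall>j<n2. i \<noteq> j \<longrightarrow> S $$ (i,j) = 0" "\<forall>i<min n1 n2. 0 \<le> S $$ (i,i)"
    using B A by (auto simp: diag_decomp_def Let_def)
  have orth: "transpose_mat (X * Y) * (X * Y) = 1\<^sub>m n"
    if "X \<in> carrier_mat n n" "transpose_mat X * X = 1\<^sub>m n" "Y \<in> carrier_mat n n" "transpose_mat Y * Y = 1\<^sub>m n"
    for X Y :: "real mat" and n
  proof -
    have "transpose_mat (X * Y) * (X * Y) = transpose_mat Y * ((transpose_mat X * X) * Y)"
      using that(1,3) by (simp add: transpose_mult[of _ n n _ n] assoc_mult_mat[of _ n n _ n _ n])
    then show ?thesis using that by simp
  qed
  have "U * A * transpose_mat V = U * P * S * transpose_mat (V * Q)"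
    unfolding Aeq using P(1) Q(1) U(1) V(1) S
    by (simp add: transpose_mult[of _ n2 n2 _ n2] assoc_mult_mat[of _ n1 n1 _ n1 _ n2]
       assoc_mult_mat[of _ n1 n1 _ n2 _ n2] assoc_mult_mat[of _ n1 n2 _ n2 _ n2])
  moreover have "dim_row (U * A * transpose_mat V) = n1" "dim_col (U * A * transpose_mat V) = n2"
    using U V by auto
  ultimately show ?thesis using P(1) Q(1) U(1) V(1) S orth[OF U P] orth[OF V Q] diag
    unfolding diag_decomp_def Let_def by (simp del: assoc_mult_mat)
qed

text \<open>Induction step for existence: bordered matrices multiply and transpose blockwise, so it
  suffices to border \<open>U\<close> and \<open>V\<close> by 1 and \<open>S\<close> by
  \<open>s\<close>.\<close>

lemma diag_decomp_block:
  fixes A :: "real mat"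
  assumes A: "A \<in> carrier_mat n1 n2" and D: "diag_decomp A U S V" and s: "s \<ge> 0"
  shows "\<exists>U' S' V'. diag_decomp (four_block_mat (mat 1 1 (\<lambda>_. s)) (0\<^sub>m 1 n2) (0\<^sub>m n1 1) A) U' S' V'"
proof -
  let ?F = "\<lambda>a m1 m2 B. four_block_mat (mat 1 1 (\<lambda>_. a)) (0\<^sub>m 1 m2) (0\<^sub>m m1 1) B"
  have U: "U \<in> carrier_mat n1 n1" "transpose_mat U * U = 1\<^sub>m n1"
    and V: "V \<in> carrier_mat n2 n2" "transpose_mat V * V = 1\<^sub>m n2" and S: "S \<in> carrier_mat n1 n2"
    and Aeq: "A = U * S * transpose_mat V"
    and diag: "\<And>i j. i < n1 \<Longrightarrow> j < n2 \<Longrightarrow> i \<noteq> j \<Longrightarrow> S $$ (i,j) = 0"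
    and nonneg: "\<And>i. i < min n1 n2 \<Longrightarrow> 0 \<le> S $$ (i,i)"
    using D A by (auto simp: diag_decomp_def Let_def)
  have mult: "?F a m1 m2 X * ?F b m2 m3 Y = ?F (a * b) m1 m3 (X * Y)"
    if "X \<in> carrier_mat m1 m2" "Y \<in> carrier_mat m2 m3" for a b :: real and X Y m1 m2 m3
  proof -
    have "mat 1 1 (\<lambda>_. a) * mat 1 1 (\<lambda>_. b) = mat 1 1 (\<lambda>_. a * b)"
      by (rule eq_matI) (auto simp: scalar_prod_def)
    then show ?thesis
      using that by (subst mult_four_block_mat[of _ 1 1 _ m2 _ m1 _ _ 1 _ m3]) auto
  qed
  have tr: "transpose_mat (?F a m1 m2 X) = ?F a m2 m1 (transpose_mat X)"
    if "X \<in> carrier_mat m1 m2" for a :: real and X m1 m2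
    using that by (subst transpose_four_block_mat[of _ 1 1 _ m2 _ m1]) (auto intro!: cong_four_block_mat)
  have one: "?F 1 m m (1\<^sub>m m) = (1\<^sub>m (Suc m) :: real mat)" for m
    by (rule eq_matI) auto
  have "?F s n1 n2 A = ?F 1 n1 n1 U * ?F s n1 n2 S * transpose_mat (?F 1 n2 n2 V)"
    using mult[OF U(1) S, of 1 s] mult[of "U * S" n1 n2 "transpose_mat V" n2 s 1] tr[OF V(1), of 1] U V S
    by (simp add: Aeq del: assoc_mult_mat)
  moreover have "transpose_mat (?F 1 n1 n1 U) * ?F 1 n1 n1 U = 1\<^sub>m (Suc n1)"
    using mult[of "transpose_mat U" n1 n1 U n1 1 1] tr[OF U(1), of 1] one[of n1] U by simp
  moreover have "transpose_mat (?F 1 n2 n2 V) * ?F 1 n2 n2 V = 1\<^sub>m (Suc n2)"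
    using mult[of "transpose_mat V" n2 n2 V n2 1 1] tr[OF V(1), of 1] one[of n2] V by simp
  moreover have "0 \<le> S $$ (i - Suc 0, i - Suc 0)" if "0 < i" "i < Suc (min n1 n2)" for i
    using nonneg[of "i - Suc 0"] that by linarith
  ultimately have "diag_decomp (?F s n1 n2 A) (?F 1 n1 n1 U) (?F s n1 n2 S) (?F 1 n2 n2 V)"
    unfolding diag_decomp_def Let_def using A U V S diag s by auto
  then show ?thesis by blast
qed

text \<open>Induction on the number of rows. A singular pair is completed to orthogonal matrices
  \<open>P\<close> and \<open>Q\<close>; in these coordinates the first row and column vanish off
  the corner, and the induction hypothesis treats the remaining block.\<close>

lemma diag_decomp_exists:
  fixes A :: "real mat"
  assumes "A \<in> carrier_mat n1 n2"
  shows "\<exists>U S V. diag_decomp A U S V"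
  using assms
proof (induction n1 arbitrary: n2 A)
  case 0
  then show ?case using diag_decomp_trivial[of A] by auto
next
  case (Suc m1)
  note A = Suc.prems
  show ?case
  proof (cases n2)
    case 0
    then show ?thesis using diag_decomp_trivial[of A] A by auto
  next
    case n2: (Suc m2)
    obtain u v s where u: "u \<in> carrier_vec (Suc m1)" "u \<bullet> u = 1" and v: "v \<in> carrier_vec n2" "v \<bullet> v = 1"
      and s: "s \<ge> 0" and Av: "A *\<^sub>v v = s \<cdot>\<^sub>v u" and Au: "transpose_mat A *\<^sub>v u = s \<cdot>\<^sub>v v"
      using singular_pair_exists[OF A] n2 by auto
    obtain P where P: "P \<in> carrier_mat (Suc m1) (Suc m1)" "transpose_mat P * P = 1\<^sub>m (Suc m1)" "col P 0 = u"
      using orthogonal_mat_with_first_col[OF u(1) _ u(2)] by auto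
    obtain Q where Q: "Q \<in> carrier_mat n2 n2" "transpose_mat Q * Q = 1\<^sub>m n2" "col Q 0 = v"
      using orthogonal_mat_with_first_col[OF v(1) _ v(2)] n2 by auto
    define B where "B = transpose_mat P * A * Q"
    have B: "B \<in> carrier_mat (Suc m1) (Suc m2)" using P Q A n2 by (simp add: B_def)
    have PA: "transpose_mat P * A \<in> carrier_mat (Suc m1) n2" using P A by simp
    have ent: "B $$ (i,j) = col P i \<bullet> (A *\<^sub>v col Q j)" if "i < Suc m1" "j < n2" for i j
    proof -
      have "B $$ (i,j) = (transpose_mat P * (A * Q)) $$ (i,j)"
        unfolding B_def using P A Q by (simp add: assoc_mult_mat[of _ "Suc m1" "Suc m1" _ n2 _ n2])
      also have "\<dots> = col P i \<bullet> (A *\<^sub>v col Q j)"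
        using that P A Q by (simp add: mult_mat_vec_def)
      finally show ?thesis .
    qed
    have orthP: "col P i \<bullet> col P 0 = (if i = 0 then 1 else 0)" if "i < Suc m1" for i
      using arg_cong[OF P(2), of "\<lambda>M. M $$ (i,0)"] that P(1) by simp
    have orthQ: "col Q 0 \<bullet> col Q j = (if j = 0 then 1 else 0)" if "j < n2" for j
      using arg_cong[OF Q(2), of "\<lambda>M. M $$ (0,j)"] that Q(1) by auto
    \<comment> \<open>The first column comes from \<open>Av\<close> and the orthonormal columns of
      \<open>P\<close>; the first row, next, from \<open>Au\<close> and the orthonormal columns of
      \<open>Q\<close>.\<close>
    have col0: "B $$ (i,0) = (if i = 0 then s else 0)" if "i < Suc m1" for i
      using ent[OF that, of 0] n2 orthP[OF that] P u that by (simp add: Q(3) Av)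
    have row0: "B $$ (0,j) = (if j = 0 then s else 0)" if "j < n2" for j
    proof -
      have cj: "col Q j \<in> carrier_vec n2" using Q that by auto
      have "B $$ (0,j) = (transpose_mat A *\<^sub>v u) \<bullet> col Q j"
        using ent[of 0 j] that P(3) transpose_vec_mult_scalar[OF A cj u(1)] by simp
      then show ?thesis using Au orthQ[OF that] Q(3) cj v by simp
    qed
    define B' where "B' = mat m1 m2 (\<lambda>(i,j). B $$ (Suc i, Suc j))"
    have B': "B' \<in> carrier_mat m1 m2" by (simp add: B'_def)
    have Beq: "B = four_block_mat (mat 1 1 (\<lambda>_. s)) (0\<^sub>m 1 m2) (0\<^sub>m m1 1) B'"
    proof (rule eq_matI)
      fix i j assume "i < dim_row (four_block_mat (mat 1 1 (\<lambda>_. s)) (0\<^sub>m 1 m2) (0\<^sub>m m1 1) B')"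
        "j < dim_col (four_block_mat (mat 1 1 (\<lambda>_. s)) (0\<^sub>m 1 m2) (0\<^sub>m m1 1) B')"
      then have "i < Suc m1" "j < Suc m2" using B' by auto
      then show "B $$ (i,j) = four_block_mat (mat 1 1 (\<lambda>_. s)) (0\<^sub>m 1 m2) (0\<^sub>m m1 1) B' $$ (i,j)"
        using col0[of i] row0[of j] n2 by (auto simp: B'_def)
    qed (use B B' in auto)
    obtain U S V where "diag_decomp B' U S V" using Suc.IH[OF B'] by blast
    then obtain U S V where "diag_decomp B U S V"
      using diag_decomp_block[OF B' _ s] unfolding Beq by blast
    then have "diag_decomp (P * B * transpose_mat Q) (P * U) S (Q * V)"
      using diag_decomp_orthogonal_change[OF _ P(1,2) Q(1,2)] B n2 by blast
    moreover have "P * B * transpose_mat Q = A"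
      unfolding B_def by (rule orthogonal_sandwich_recover[OF A P(1,2) Q(1,2)])
    ultimately show ?thesis by auto
  qed
qed

section \<open>Uniqueness of singular values\<close>

lemma is_svdD:
  assumes "is_svd A U S V" "A \<in> carrier_mat n1 n2"
  shows "U \<in> carrier_mat n1 n1" "transpose_mat U * U = 1\<^sub>m n1"
    and "V \<in> carrier_mat n2 n2" "transpose_mat V * V = 1\<^sub>m n2"
    and "S \<in> carrier_mat n1 n2"
    and "\<And>i j. i < n1 \<Longrightarrow> j < n2 \<Longrightarrow> i \<noteq> j \<Longrightarrow> S $$ (i,j) = 0"
    and "\<And>i. i < min n1 n2 \<Longrightarrow> 0 \<le> S $$ (i,i)"
    and "\<And>i j. i \<le> j \<Longrightarrow> j < min n1 n2 \<Longrightarrow> S $$ (j,j) \<le> S $$ (i,i)"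
    and "A = U * S * transpose_mat V"
proof -
  have "dim_row A = n1" "dim_col A = n2" using assms(2) by auto
  note * = assms(1)[unfolded is_svd_def Let_def this]
  show "U \<in> carrier_mat n1 n1" "transpose_mat U * U = 1\<^sub>m n1"
    "V \<in> carrier_mat n2 n2" "transpose_mat V * V = 1\<^sub>m n2" "S \<in> carrier_mat n1 n2"
    "\<And>i j. i < n1 \<Longrightarrow> j < n2 \<Longrightarrow> i \<noteq> j \<Longrightarrow> S $$ (i,j) = 0"
    "\<And>i. i < min n1 n2 \<Longrightarrow> 0 \<le> S $$ (i,i)"
    "\<And>i j. i \<le> j \<Longrightarrow> j < min n1 n2 \<Longrightarrow> S $$ (j,j) \<le> S $$ (i,i)"
    "A = U * S * transpose_mat V"
    using * by blast+
qed

text \<open>With this entry formula, permuting the columns of \<open>U\<close> and \<open>V\<close>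
  together with the diagonal becomes the reindexing of a sum.\<close>

lemma diag_sandwich_index:
  fixes U S V :: "real mat"
  assumes U: "U \<in> carrier_mat n1 n1" and S: "S \<in> carrier_mat n1 n2" and V: "V \<in> carrier_mat n2 n2"
    and diag: "\<And>i j. i < n1 \<Longrightarrow> j < n2 \<Longrightarrow> i \<noteq> j \<Longrightarrow> S $$ (i,j) = 0"
    and i: "i < n1" and j: "j < n2"
  shows "(U * S * transpose_mat V) $$ (i,j) = (\<Sum>l<min n1 n2. U $$ (i,l) * S $$ (l,l) * V $$ (j,l))"
proof -
  have US: "(U * S) $$ (i,l) = (if l < n1 then U $$ (i,l) * S $$ (l,l) else 0)" if l: "l < n2" for l
  proof -
    have "(U * S) $$ (i,l) = (\<Sum>k<n1. U $$ (i,k) * S $$ (k,l))"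
      using U S i l by (simp add: scalar_prod_def lessThan_atLeast0)
    also have "\<dots> = (\<Sum>k<n1. if k = l then U $$ (i,l) * S $$ (l,l) else 0)"
      using diag l by (intro sum.cong) auto
    finally show ?thesis by simp
  qed
  have "(U * S * transpose_mat V) $$ (i,j) = (\<Sum>l<n2. (U * S) $$ (i,l) * V $$ (j,l))"
  proof -
    have "(X * transpose_mat V) $$ (i,j) = (\<Sum>l<n2. X $$ (i,l) * V $$ (j,l))" if "X \<in> carrier_mat n1 n2" for X
      using that V i j by (simp add: scalar_prod_def lessThan_atLeast0)
    then show ?thesis using mult_carrier_mat[OF U S] by blast
  qed
  also have "\<dots> = (\<Sum>l<n2. if l < n1 then U $$ (i,l) * S $$ (l,l) * V $$ (j,l) else 0)"
    using US by (intro sum.cong) auto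
  also have "\<dots> = (\<Sum>l<min n1 n2. U $$ (i,l) * S $$ (l,l) * V $$ (j,l))"
    by (rule sum.mono_neutral_cong_right) auto
  finally show ?thesis .
qed

section \<open>Sorting the diagonal into descending order\<close>

lemma antimono_permutation_exists:
  fixes s :: "nat \<Rightarrow> real"
  shows "\<exists>p. bij_betw p {..<k} {..<k} \<and> (\<forall>i j. i \<le> j \<longrightarrow> j < k \<longrightarrow> s (p j) \<le> s (p i))"
proof -
  define xs where "xs = sort_key (\<lambda>i. - s i) [0..<k]"
  have xs: "length xs = k" "distinct xs" "set xs = {..<k}" by (auto simp: xs_def)
  have "bij_betw ((!) xs) {..<k} {..<k}"
    by (rule bij_betw_nth[OF xs(2)]) (simp_all only: xs)
  moreover have "s (xs ! j) \<le> s (xs ! i)" if "i \<le> j" "j < k" for i j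
    using sorted_nth_mono[of "map (\<lambda>i. - s i) xs" i j] that xs(1) by (simp add: xs_def)
  ultimately show ?thesis by blast
qed

lemma orthogonal_mat_permute_cols:
  fixes U :: "real mat"
  assumes U: "U \<in> carrier_mat n n" "transpose_mat U * U = 1\<^sub>m n" and p: "bij_betw p {..<n} {..<n}"
  shows "transpose_mat (mat n n (\<lambda>(i,j). U $$ (i, p j))) * mat n n (\<lambda>(i,j). U $$ (i, p j)) = 1\<^sub>m n"
proof (rule eq_matI)
  fix i j assume "i < dim_row (1\<^sub>m n :: real mat)" "j < dim_col (1\<^sub>m n :: real mat)"
  then have ij: "i < n" "j < n" by auto
  then have pij: "p i < n" "p j < n" using p by (auto simp: bij_betw_def)
  have "(transpose_mat (mat n n (\<lambda>(i,j). U $$ (i, p j))) * mat n n (\<lambda>(i,j). U $$ (i, p j))) $$ (i,j)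
    = (\<Sum>k<n. U $$ (k, p i) * U $$ (k, p j))"
    using ij by (simp add: scalar_prod_def lessThan_atLeast0)
  also have "\<dots> = (transpose_mat U * U) $$ (p i, p j)"
    using pij U(1) by (simp add: scalar_prod_def lessThan_atLeast0)
  also have "\<dots> = 1\<^sub>m n $$ (i,j)"
    using U(2) pij ij bij_betw_imp_inj_on[OF p] by (auto simp: inj_on_eq_iff)
  finally show "(transpose_mat (mat n n (\<lambda>(i,j). U $$ (i, p j))) * mat n n (\<lambda>(i,j). U $$ (i, p j))) $$ (i,j)
    = 1\<^sub>m n $$ (i,j)" .
qed auto

lemma svd_exists: "\<exists>U S V. is_svd A U S V"
proof -
  obtain n1 n2 where A: "A \<in> carrier_mat n1 n2" and dims: "dim_row A = n1" "dim_col A = n2" by auto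
  define k where "k = min n1 n2"
  obtain U S V where "diag_decomp A U S V" using diag_decomp_exists[OF A] by blast
  then have U: "U \<in> carrier_mat n1 n1" "transpose_mat U * U = 1\<^sub>m n1"
    and V: "V \<in> carrier_mat n2 n2" "transpose_mat V * V = 1\<^sub>m n2" and S: "S \<in> carrier_mat n1 n2"
    and Aeq: "A = U * S * transpose_mat V"
    and diag: "\<And>i j. i < n1 \<Longrightarrow> j < n2 \<Longrightarrow> i \<noteq> j \<Longrightarrow> S $$ (i,j) = 0"
    and nonneg: "\<And>i. i < k \<Longrightarrow> 0 \<le> S $$ (i,i)"
    unfolding diag_decomp_def Let_def dims k_def by blast+
  obtain q where q: "bij_betw q {..<k} {..<k}"
    and mono: "\<And>i j. i \<le> j \<Longrightarrow> j < k \<Longrightarrow> S $$ (q j, q j) \<le> S $$ (q i, q i)"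
    using antimono_permutation_exists[of k "\<lambda>i. S $$ (i,i)"] by blast
  \<comment> \<open>Sorting concerns only the first \<open>k\<close> indices. Extended by the
    identity, one and the same map permutes the columns of \<open>U\<close> and of \<open>V\<close>,
    although their numbers may differ.\<close>
  define p where "p i = (if i < k then q i else i)" for i
  have bij: "bij_betw p {..<n} {..<n}" if "k \<le> n" for n
  proof -
    have "bij_betw p {..<k} {..<k}" using q by (rule bij_betw_cong[THEN iffD1, rotated]) (simp add: p_def)
    moreover have "bij_betw p {k..<n} {k..<n}"
      by (rule bij_betw_cong[THEN iffD1, OF _ bij_betw_id]) (simp add: p_def)
    ultimately have "bij_betw p ({..<k} \<union> {k..<n}) ({..<k} \<union> {k..<n})"
      by (rule bij_betw_combine) auto
    moreover have "{..<k} \<union> {k..<n} = {..<n}" using that by auto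
    ultimately show ?thesis by simp
  qed
  have pk: "p i < k" if "i < k" for i using that bij[of k] by (auto simp: bij_betw_def)
  have k: "k \<le> n1" "k \<le> n2" by (auto simp: k_def)
  define U' where "U' = mat n1 n1 (\<lambda>(i,j). U $$ (i, p j))"
  define V' where "V' = mat n2 n2 (\<lambda>(i,j). V $$ (i, p j))"
  define S' where "S' = mat n1 n2 (\<lambda>(i,j). if i = j then S $$ (p i, p i) else 0)"
  have "A = U' * S' * transpose_mat V'"
  proof (rule eq_matI)
    fix i j assume "i < dim_row (U' * S' * transpose_mat V')" "j < dim_col (U' * S' * transpose_mat V')"
    then have ij: "i < n1" "j < n2" by (auto simp: U'_def V'_def)
    have "A $$ (i,j) = (\<Sum>l<k. U $$ (i,l) * S $$ (l,l) * V $$ (j,l))"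
      unfolding Aeq using diag_sandwich_index[OF U(1) S V(1) diag ij] by (simp add: k_def)
    also have "\<dots> = (\<Sum>l<k. U $$ (i,p l) * S $$ (p l,p l) * V $$ (j,p l))"
      using sum.reindex_bij_betw[OF bij[of k], of "\<lambda>l. U $$ (i,l) * S $$ (l,l) * V $$ (j,l)"] by simp
    also have "\<dots> = (\<Sum>l<k. U' $$ (i,l) * S' $$ (l,l) * V' $$ (j,l))"
      using ij k by (intro sum.cong) (auto simp: U'_def S'_def V'_def)
    also have "\<dots> = (U' * S' * transpose_mat V') $$ (i,j)"
      using ij by (subst diag_sandwich_index[of _ n1 _ n2]) (auto simp: U'_def S'_def V'_def k_def)
    finally show "A $$ (i,j) = (U' * S' * transpose_mat V') $$ (i,j)" .
  qed (use A in \<open>auto simp: U'_def V'_def\<close>)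
  moreover have "transpose_mat U' * U' = 1\<^sub>m n1" "transpose_mat V' * V' = 1\<^sub>m n2"
    unfolding U'_def V'_def using orthogonal_mat_permute_cols[OF U bij] orthogonal_mat_permute_cols[OF V bij] k by auto
  moreover have "\<forall>i<k. 0 \<le> S' $$ (i,i)" using nonneg[OF pk] k by (simp add: S'_def)
  moreover have "\<forall>i j. i \<le> j \<longrightarrow> j < k \<longrightarrow> S' $$ (j,j) \<le> S' $$ (i,i)"
    using mono k by (simp add: S'_def p_def)
  moreover have "U' \<in> carrier_mat n1 n1" "V' \<in> carrier_mat n2 n2" "S' \<in> carrier_mat n1 n2"
    by (auto simp: U'_def V'_def S'_def)
  moreover have "\<forall>i<n1. \<forall>j<n2. i \<noteq> j \<longrightarrow> S' $$ (i,j) = 0" by (simp add: S'_def)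
  ultimately have "is_svd A U' S' V'" 
    unfolding is_svd_def Let_def dims k_def by (intro conjI)
  then show ?thesis by blast
qed

section \<open>Singular values as roots of the characteristic polynomial of the Gram matrix\<close>

lemma proots_prod_list_linear:
  fixes xs :: "'a :: field list"
  shows "proots (\<Prod>a\<leftarrow>xs. [:- a, 1:]) = mset xs"
proof (induction xs)
  case (Cons a xs)
  have "(\<Prod>a\<leftarrow>xs. [:- a, 1:]) \<noteq> 0" by (auto simp: prod_list_zero_iff)
  then show ?case using Cons by (simp add: proots_mult del: mult_pCons_left)
qed simp

text \<open>The factor \<open>U\<close> cancels in the Gram matrix, which is therefore similar
  through \<open>V\<close> to the diagonal matrix \<open>transpose_mat S * S\<close>. Its diagonal
  consists of the squared singular values, filled up with zeros if there are more columns than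
  rows.\<close>

lemma svd_char_poly_gram:
  assumes svd: "is_svd A U S V"
  shows "char_poly (transpose_mat A * A)
    = (\<Prod>a\<leftarrow>map (\<lambda>i. if i < dim_row A then (S $$ (i,i))^2 else 0) [0..<dim_col A]. [:- a, 1:])"
proof -
  obtain n1 n2 where A: "A \<in> carrier_mat n1 n2" and dims: "dim_row A = n1" "dim_col A = n2" by auto
  have U: "U \<in> carrier_mat n1 n1" "transpose_mat U * U = 1\<^sub>m n1"
    and V: "V \<in> carrier_mat n2 n2" "transpose_mat V * V = 1\<^sub>m n2" and S: "S \<in> carrier_mat n1 n2"
    and Aeq: "A = U * S * transpose_mat V"
    and diag: "\<And>i j. i < n1 \<Longrightarrow> j < n2 \<Longrightarrow> i \<noteq> j \<Longrightarrow> S $$ (i,j) = 0"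
    using is_svdD[OF svd A] by blast+
  let ?D = "transpose_mat S * S"
  have carr: "transpose_mat U \<in> carrier_mat n1 n1" "transpose_mat V \<in> carrier_mat n2 n2"
    "transpose_mat S \<in> carrier_mat n2 n1" "S * transpose_mat V \<in> carrier_mat n1 n2"
    "V * transpose_mat S \<in> carrier_mat n2 n1" "U * (S * transpose_mat V) \<in> carrier_mat n1 n2"
    using U V S by auto
  have "A = U * (S * transpose_mat V)" unfolding Aeq using U V S by (simp add: assoc_mult_mat)
  moreover have "transpose_mat A = V * transpose_mat S * transpose_mat U"
    unfolding Aeq using transpose_mult[OF mult_carrier_mat[OF U(1) S] carr(2)] transpose_mult[OF U(1) S]
    assoc_mult_mat[OF V(1) carr(3,1)] by simp
  ultimately have "transpose_mat A * A = V * transpose_mat S * transpose_mat U * (U * (S * transpose_mat V))" by metis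
  also have "\<dots> = V * transpose_mat S * (transpose_mat U * (U * (S * transpose_mat V)))"
    by (rule assoc_mult_mat[OF carr(5,1,6)])
  also have "transpose_mat U * (U * (S * transpose_mat V)) = S * transpose_mat V"
    using assoc_mult_mat[OF carr(1) U(1) carr(4)] U(2) left_mult_one_mat[OF carr(4)] by simp
  also have "V * transpose_mat S * (S * transpose_mat V) = V * ?D * transpose_mat V"
    using assoc_mult_mat[OF carr(5) S carr(2)] assoc_mult_mat[OF V(1) carr(3) S] by metis
  finally have "transpose_mat A * A = V * ?D * transpose_mat V" .
  then have "similar_mat_wit (transpose_mat A * A) ?D V (transpose_mat V)"
    using V S orthogonal_mat_comm[OF V] by (intro similar_mat_witI[of _ _ n2]) (use A in auto)
  then have "char_poly (transpose_mat A * A) = char_poly ?D"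
    by (intro char_poly_similar) (auto simp: similar_mat_def)
  moreover have ent: "?D $$ (i,j) = (if i = j \<and> i < n1 then (S $$ (i,i))^2 else 0)" if ij: "i < n2" "j < n2" for i j
  proof -
    have "?D $$ (i,j) = (\<Sum>k<n1. S $$ (k,i) * S $$ (k,j))"
      using S ij by (simp add: scalar_prod_def lessThan_atLeast0)
    also have "\<dots> = (\<Sum>k<n1. if k = i then (if i = j then (S $$ (i,i))^2 else 0) else 0)"
      using diag ij by (intro sum.cong) (auto simp: power2_eq_square)
    finally show ?thesis by simp
  qed
  have "upper_triangular ?D" using ent S by (intro upper_triangularI) auto
  then have "char_poly ?D = (\<Prod>a\<leftarrow>diag_mat ?D. [:- a, 1:])"
    using S by (intro char_poly_upper_triangular[of _ n2]) auto
  moreover have "diag_mat ?D = map (\<lambda>i. if i < n1 then (S $$ (i,i))^2 else 0) [0..<n2]"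
    using S ent by (auto simp: diag_mat_def simp del: index_mult_mat(1))
  ultimately show ?thesis by (simp add: dims)
qed

text \<open>The characteristic polynomial depends on \<open>A\<close> alone, so any two
  decompositions have the same multiset of squared diagonal entries. Both lists are descending,
  hence equal, and nonnegative numbers with equal squares agree.\<close>

lemma svd_unique:
  assumes "is_svd A U S V" "is_svd A U' S' V'" and i: "i < min (dim_row A) (dim_col A)"
  shows "S $$ (i,i) = S' $$ (i,i)"
proof -
  let ?d = "\<lambda>S. map (\<lambda>i. if i < dim_row A then (S $$ (i,i))^2 else (0::real)) [0..<dim_col A]"
  \<comment> \<open>The filling zeros stand at the end, so the squares of the descending nonnegative
    diagonal remain descending.\<close>
  have sorted: "sorted (rev (?d S))" if "is_svd A U S V" for U S V
  proof -
    have "(if j < dim_row A then (S $$ (j,j))^2 else 0) \<le> (if i < dim_row A then (S $$ (i,i))^2 else 0)"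
      if "i \<le> j" "j < dim_col A" for i j
      using that is_svdD(7,8)[OF \<open>is_svd A U S V\<close> carrier_matI[OF refl refl]] by (auto intro!: power_mono)
    then have "?d S ! j \<le> ?d S ! i" if "i \<le> j" "j < length (?d S)" for i j
      using that by (simp split del: if_split cong del: if_weak_cong)
    then show ?thesis unfolding sorted_rev_iff_nth_mono by blast
  qed
  have roots: "proots (char_poly (transpose_mat A * A)) = mset (?d S)" if "is_svd A U S V" for U S V
    unfolding svd_char_poly_gram[OF that] by (rule proots_prod_list_linear)
  have "mset (?d S) = mset (?d S')" using roots[OF assms(1)] roots[OF assms(2)] by (rule trans[OF sym])
  then have "rev (?d S) = rev (?d S')"
    using properties_for_sort[of "rev (?d S)" "?d S", OF _ sorted[OF assms(1)]]
      properties_for_sort[of "rev (?d S')" "?d S", OF _ sorted[OF assms(2)]] by simp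
  then have "?d S = ?d S'" by (simp only: rev_is_rev_conv)
  then have "?d S ! i = ?d S' ! i" by (rule arg_cong)
  then have "(S $$ (i,i))^2 = (S' $$ (i,i))^2" using i by simp
  moreover have "S $$ (i,i) \<ge> 0" "S' $$ (i,i) \<ge> 0"
    using is_svdD(7)[OF assms(1) carrier_matI[OF refl refl] i] is_svdD(7)[OF assms(2) carrier_matI[OF refl refl] i] by auto
  ultimately show ?thesis by (rule power2_eq_imp_eq)
qed

text \<open>Uniqueness of the diagonal resolves the definite description in \<open>sing_val\<close>:
  any decomposition may be used to compute it.\<close>

lemma sing_val_eq:
  assumes svd: "is_svd A U S V"
  shows "sing_val A i = (if 1 \<le> i \<and> i \<le> min (dim_row A) (dim_col A) then S $$ (i-1, i-1) else 0)"
  unfolding sing_val_def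
proof (rule the_equality)
  fix s assume "\<exists>U S V. is_svd A U S V \<and>
      s = (if 1 \<le> i \<and> i \<le> min (dim_row A) (dim_col A) then S $$ (i-1, i-1) else 0)"
  then obtain U' S' V' where svd': "is_svd A U' S' V'"
    and s: "s = (if 1 \<le> i \<and> i \<le> min (dim_row A) (dim_col A) then S' $$ (i-1, i-1) else 0)" by blast
  show "s = (if 1 \<le> i \<and> i \<le> min (dim_row A) (dim_col A) then S $$ (i-1, i-1) else 0)"
  proof (cases "1 \<le> i \<and> i \<le> min (dim_row A) (dim_col A)")
    case True
    then have "i - 1 < min (dim_row A) (dim_col A)" by linarith
    then show ?thesis using svd_unique[OF svd' svd] s True by simp
  qed (use s in auto)
qed (use svd in blast)

lemma sum_sing_val_eq:
  assumes svd: "is_svd A U S V"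
  shows "(\<Sum>i=r+1..min (dim_row A) (dim_col A). sing_val A i) = (\<Sum>i=r..<min (dim_row A) (dim_col A). S $$ (i,i))"
  \<comment> \<open>Singular values count from 1, diagonal positions from 0; hence the
    shift.\<close>
  by (rule sum.reindex_bij_witness[of _ Suc "\<lambda>i. i - 1"]) (auto simp: sing_val_eq[OF svd])

lemma nuc_norm_eq:
  assumes svd: "is_svd A U S V"
  shows "nuc_norm A = (\<Sum>i<min (dim_row A) (dim_col A). S $$ (i,i))"
  using sum_sing_val_eq[OF svd, of 0] by (simp add: nuc_norm_def lessThan_atLeast0)

section \<open>Duality between the nuclear and the operator norm\<close>

text \<open>The trace inner product, which induces the Frobenius norm.\<close>

definition mat_inner :: "real mat \<Rightarrow> real mat \<Rightarrow> real" where
  "mat_inner A B = (\<Sum>i<dim_row A. \<Sum>j<dim_col A. A $$ (i,j) * B $$ (i,j))"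

text \<open>Operator norm at most \<open>c\<close>, expressed by squared lengths so that neither a
  supremum nor a square root occurs.\<close>

definition norm_bounded :: "real \<Rightarrow> real mat \<Rightarrow> bool" where
  "norm_bounded c Z \<longleftrightarrow> 0 \<le> c \<and> (\<forall>x\<in>carrier_vec (dim_col Z). (Z *\<^sub>v x) \<bullet> (Z *\<^sub>v x) \<le> c^2 * (x \<bullet> x))"

lemma scalar_prod_self: "x \<in> carrier_vec n \<Longrightarrow> x \<bullet> x = (\<Sum>i<n. (x $ i :: real)^2)"
  by (simp add: scalar_prod_def lessThan_atLeast0 power2_eq_square)

lemma mat_inner_commute:
  "A \<in> carrier_mat n1 n2 \<Longrightarrow> B \<in> carrier_mat n1 n2 \<Longrightarrow> mat_inner A B = mat_inner B A"
  by (simp add: mat_inner_def mult.commute)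

lemma mat_inner_add_left:
  "A \<in> carrier_mat n1 n2 \<Longrightarrow> B \<in> carrier_mat n1 n2 \<Longrightarrow> mat_inner (A + B) C = mat_inner A C + mat_inner B C"
  by (simp add: mat_inner_def algebra_simps sum.distrib)

lemma mat_inner_add_right:
  "A \<in> carrier_mat n1 n2 \<Longrightarrow> B \<in> carrier_mat n1 n2 \<Longrightarrow> C \<in> carrier_mat n1 n2 \<Longrightarrow>
    mat_inner C (A + B) = mat_inner C A + mat_inner C B"
  by (simp add: mat_inner_def algebra_simps sum.distrib)

lemma fro_norm_sq: "(fro_norm A)^2 = mat_inner A A"
  by (simp add: fro_norm_def mat_inner_def power2_eq_square[symmetric] sum_nonneg)

lemma fro_norm_nonneg: "fro_norm A \<ge> 0"
  by (simp add: fro_norm_def sum_nonneg)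

section \<open>Adjoints and orthogonal invariance\<close>

lemma mat_inner_mult_left:
  assumes "P \<in> carrier_mat n1 m" "X \<in> carrier_mat m n2" "Y \<in> carrier_mat n1 n2"
  shows "mat_inner (P * X) Y = mat_inner X (transpose_mat P * Y)"
proof -
  have "mat_inner (P * X) Y = (\<Sum>i<n1. \<Sum>j<n2. \<Sum>k<m. P $$ (i,k) * X $$ (k,j) * Y $$ (i,j))"
    using assms by (simp add: mat_inner_def scalar_prod_def lessThan_atLeast0 sum_distrib_right)
  also have "\<dots> = (\<Sum>i<n1. \<Sum>k<m. \<Sum>j<n2. P $$ (i,k) * X $$ (k,j) * Y $$ (i,j))"
    by (intro sum.cong sum.swap refl)
  also have "\<dots> = (\<Sum>k<m. \<Sum>i<n1. \<Sum>j<n2. P $$ (i,k) * X $$ (k,j) * Y $$ (i,j))"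
    by (rule sum.swap)
  also have "\<dots> = (\<Sum>k<m. \<Sum>j<n2. \<Sum>i<n1. P $$ (i,k) * X $$ (k,j) * Y $$ (i,j))"
    by (intro sum.cong sum.swap refl)
  also have "\<dots> = mat_inner X (transpose_mat P * Y)"
    using assms by (simp add: mat_inner_def scalar_prod_def lessThan_atLeast0 sum_distrib_left ac_simps)
  finally show ?thesis .
qed

lemma mat_inner_mult_right:
  assumes "X \<in> carrier_mat n1 m" "Q \<in> carrier_mat m n2" "Y \<in> carrier_mat n1 n2"
  shows "mat_inner (X * Q) Y = mat_inner X (Y * transpose_mat Q)"
proof -
  have "mat_inner (X * Q) Y = (\<Sum>i<n1. \<Sum>j<n2. \<Sum>k<m. X $$ (i,k) * Q $$ (k,j) * Y $$ (i,j))"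
    using assms by (simp add: mat_inner_def scalar_prod_def lessThan_atLeast0 sum_distrib_right)
  also have "\<dots> = (\<Sum>i<n1. \<Sum>k<m. \<Sum>j<n2. X $$ (i,k) * Q $$ (k,j) * Y $$ (i,j))"
    by (intro sum.cong sum.swap refl)
  also have "\<dots> = mat_inner X (Y * transpose_mat Q)"
    using assms by (simp add: mat_inner_def scalar_prod_def lessThan_atLeast0 sum_distrib_left ac_simps)
  finally show ?thesis .
qed

lemma mat_inner_sandwich:
  assumes U: "U \<in> carrier_mat n1 n1" and V: "V \<in> carrier_mat n2 n2"
    and X: "X \<in> carrier_mat n1 n2" and Y: "Y \<in> carrier_mat n1 n2"
  shows "mat_inner (U * X * transpose_mat V) Y = mat_inner X (transpose_mat U * Y * V)"
proof -
  have "mat_inner (U * X * transpose_mat V) Y = mat_inner (U * X) (Y * V)"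
    using mat_inner_mult_right[of "U * X" n1 n2 "transpose_mat V" n2 Y] assms by simp
  also have "\<dots> = mat_inner X (transpose_mat U * (Y * V))"
    using mat_inner_mult_left[of U n1 n1 X n2 "Y * V"] assms by simp
  finally show ?thesis using assms by simp
qed

lemma orthogonal_sandwich_cancel:
  fixes X :: "real mat"
  assumes U: "U \<in> carrier_mat n1 n1" "transpose_mat U * U = 1\<^sub>m n1"
    and V: "V \<in> carrier_mat n2 n2" "transpose_mat V * V = 1\<^sub>m n2" and X: "X \<in> carrier_mat n1 n2"
  shows "transpose_mat U * (U * X * transpose_mat V) * V = X"
  using orthogonal_sandwich_recover[of X n1 n2 "transpose_mat U" "transpose_mat V"] assms
    orthogonal_mat_comm[OF U] orthogonal_mat_comm[OF V] by simp

lemma fro_norm_orthogonal: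
  assumes U: "U \<in> carrier_mat n1 n1" "transpose_mat U * U = 1\<^sub>m n1"
    and V: "V \<in> carrier_mat n2 n2" "transpose_mat V * V = 1\<^sub>m n2" and X: "X \<in> carrier_mat n1 n2"
  shows "fro_norm (U * X * transpose_mat V) = fro_norm X"
proof -
  have "mat_inner (U * X * transpose_mat V) (U * X * transpose_mat V)
    = mat_inner X (transpose_mat U * (U * X * transpose_mat V) * V)"
    using U V X by (intro mat_inner_sandwich) auto
  also have "\<dots> = mat_inner X X" unfolding orthogonal_sandwich_cancel[OF U V X] ..
  finally have "(fro_norm (U * X * transpose_mat V))^2 = (fro_norm X)^2" unfolding fro_norm_sq .
  then show ?thesis by (rule power2_eq_imp_eq[OF _ fro_norm_nonneg fro_norm_nonneg])
qed

text \<open>The orthogonal factors are absorbed into those of a decomposition of \<open>X\<close>,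
  whose descending diagonal stays the same.\<close>

lemma nuc_norm_orthogonal:
  assumes U: "U \<in> carrier_mat n1 n1" "transpose_mat U * U = 1\<^sub>m n1"
    and V: "V \<in> carrier_mat n2 n2" "transpose_mat V * V = 1\<^sub>m n2" and X: "X \<in> carrier_mat n1 n2"
  shows "nuc_norm (U * X * transpose_mat V) = nuc_norm X"
proof -
  obtain P S Q where svd: "is_svd X P S Q" using svd_exists by blast
  then have "diag_decomp X P S Q" unfolding is_svd_def diag_decomp_def Let_def by (elim conjE) (intro conjI)
  then have "diag_decomp (U * X * transpose_mat V) (U * P) S (V * Q)"
    by (rule diag_decomp_orthogonal_change[OF X U V])
  moreover have dims: "dim_row (U * X * transpose_mat V) = n1" "dim_col (U * X * transpose_mat V) = n2"
    using U V by auto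
  moreover have "\<forall>i j. i \<le> j \<longrightarrow> j < min n1 n2 \<longrightarrow> S $$ (j,j) \<le> S $$ (i,i)"
    using is_svdD(8)[OF svd X] by blast
  ultimately have "is_svd (U * X * transpose_mat V) (U * P) S (V * Q)"
    unfolding is_svd_def diag_decomp_def Let_def dims by (elim conjE) (intro conjI)
  from nuc_norm_eq[OF this] nuc_norm_eq[OF svd] show ?thesis using X unfolding dims by simp
qed

section \<open>Matrices of bounded operator norm\<close>

lemma norm_bounded_mult:
  assumes X: "X \<in> carrier_mat n1 m" "norm_bounded c X" and Y: "Y \<in> carrier_mat m n2" "norm_bounded d Y"
  shows "norm_bounded (c * d) (X * Y)"
  unfolding norm_bounded_def
proof (intro conjI ballI)
  show "0 \<le> c * d" using X Y by (simp add: norm_bounded_def)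
  fix x :: "real vec" assume "x \<in> carrier_vec (dim_col (X * Y))"
  then have x: "x \<in> carrier_vec n2" using Y by simp
  then have Yx: "Y *\<^sub>v x \<in> carrier_vec m" using Y by simp
  have "(X * Y *\<^sub>v x) \<bullet> (X * Y *\<^sub>v x) = (X *\<^sub>v (Y *\<^sub>v x)) \<bullet> (X *\<^sub>v (Y *\<^sub>v x))"
    using X Y x by simp
  also have "\<dots> \<le> c^2 * ((Y *\<^sub>v x) \<bullet> (Y *\<^sub>v x))" using X Yx by (simp add: norm_bounded_def)
  also have "\<dots> \<le> c^2 * (d^2 * (x \<bullet> x))" using Y x by (intro mult_left_mono) (auto simp: norm_bounded_def)
  finally show "(X * Y *\<^sub>v x) \<bullet> (X * Y *\<^sub>v x) \<le> (c * d)^2 * (x \<bullet> x)" by (simp add: power_mult_distrib)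
qed

lemma norm_bounded_orthogonal:
  assumes U: "U \<in> carrier_mat n n" "transpose_mat U * U = 1\<^sub>m n"
  shows "norm_bounded 1 U"
  unfolding norm_bounded_def
proof (intro conjI ballI)
  fix x :: "real vec" assume "x \<in> carrier_vec (dim_col U)"
  then have x: "x \<in> carrier_vec n" "U *\<^sub>v x \<in> carrier_vec n" using U by auto
  have "(U *\<^sub>v x) \<bullet> (U *\<^sub>v x) = (transpose_mat U *\<^sub>v (U *\<^sub>v x)) \<bullet> x"
    using transpose_vec_mult_scalar[OF U(1) x] by simp
  also have "transpose_mat U *\<^sub>v (U *\<^sub>v x) = x"
    using assoc_mult_mat_vec[of "transpose_mat U" n n U n x] U x by simp
  finally show "(U *\<^sub>v x) \<bullet> (U *\<^sub>v x) \<le> 1^2 * (x \<bullet> x)" by simp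
qed simp

lemma norm_bounded_diag:
  assumes S: "S \<in> carrier_mat n1 n2" and diag: "\<And>i j. i < n1 \<Longrightarrow> j < n2 \<Longrightarrow> i \<noteq> j \<Longrightarrow> S $$ (i,j) = 0"
    and le: "\<And>i. i < n1 \<Longrightarrow> i < n2 \<Longrightarrow> \<bar>S $$ (i,i)\<bar> \<le> c" and c: "0 \<le> c"
  shows "norm_bounded c S"
  unfolding norm_bounded_def
proof (intro conjI ballI)
  fix x :: "real vec" assume "x \<in> carrier_vec (dim_col S)"
  then have x: "x \<in> carrier_vec n2" using S by auto
  have ent: "(S *\<^sub>v x) $ i = (if i < n2 then S $$ (i,i) * x $ i else 0)" if i: "i < n1" for i
  proof -
    have "(S *\<^sub>v x) $ i = (\<Sum>j<n2. S $$ (i,j) * x $ j)"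
      using S x i by (simp add: scalar_prod_def lessThan_atLeast0)
    also have "\<dots> = (\<Sum>j<n2. if j = i then S $$ (i,i) * x $ i else 0)"
      using diag i by (intro sum.cong) auto
    finally show ?thesis by simp
  qed
  have "(S *\<^sub>v x) \<bullet> (S *\<^sub>v x) = (\<Sum>i<n1. ((S *\<^sub>v x) $ i)^2)"
    using S x by (intro scalar_prod_self) simp
  also have "\<dots> = (\<Sum>i<n1. if i < n2 then (S $$ (i,i))^2 * (x $ i)^2 else 0)"
    using ent by (intro sum.cong) (auto simp: power_mult_distrib)
  also have "\<dots> = (\<Sum>i<min n1 n2. (S $$ (i,i))^2 * (x $ i)^2)"
    by (rule sum.mono_neutral_cong_right) auto
  also have "\<dots> \<le> (\<Sum>i<min n1 n2. c^2 * (x $ i)^2)"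
    using le c by (intro sum_mono mult_right_mono) (auto simp: abs_le_square_iff[symmetric])
  also have "\<dots> \<le> (\<Sum>i<n2. c^2 * (x $ i)^2)" by (rule sum_mono2) auto
  also have "\<dots> = c^2 * (x \<bullet> x)" using scalar_prod_self[OF x] by (simp add: sum_distrib_left)
  finally show "(S *\<^sub>v x) \<bullet> (S *\<^sub>v x) \<le> c^2 * (x \<bullet> x)" .
qed (rule c)

lemma norm_bounded_col:
  assumes Y: "Y \<in> carrier_mat n1 n2" "norm_bounded c Y" and j: "j < n2"
  shows "(\<Sum>i<n1. (Y $$ (i,j))^2) \<le> c^2"
proof -
  have "Y *\<^sub>v unit_vec n2 j = col Y j" using Y j by auto
  then have "(\<Sum>i<n1. (Y $$ (i,j))^2) = (Y *\<^sub>v unit_vec n2 j) \<bullet> (Y *\<^sub>v unit_vec n2 j)"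
    using scalar_prod_self[of "col Y j" n1] Y j by simp
  also have "\<dots> \<le> c^2 * (unit_vec n2 j \<bullet> unit_vec n2 j)" using Y by (auto simp: norm_bounded_def)
  finally show ?thesis using j by simp
qed

text \<open>Columns are images of unit vectors; for a row, \<open>Y\<close> is applied to that row
  itself. Entry \<open>i\<close> of the image is the squared length \<open>R\<close> of the row, so
  \<open>R^2 \<le> c^2 * R\<close>, and a nonzero \<open>R\<close> cancels.\<close>

lemma norm_bounded_row:
  assumes Y: "Y \<in> carrier_mat n1 n2" "norm_bounded c Y" and i: "i < n1"
  shows "(\<Sum>j<n2. (Y $$ (i,j))^2) \<le> c^2"
proof -
  define R where "R = (\<Sum>j<n2. (Y $$ (i,j))^2)"
  have w: "row Y i \<in> carrier_vec n2" using Y i by auto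
  have R: "R = row Y i \<bullet> row Y i" using scalar_prod_self[OF w] Y i by (simp add: R_def)
  have "R^2 = ((Y *\<^sub>v row Y i) $ i)^2" using Y i by (simp add: R)
  also have "\<dots> \<le> (\<Sum>l<n1. ((Y *\<^sub>v row Y i) $ l)^2)"
    using i by (intro member_le_sum) auto
  also have "\<dots> = (Y *\<^sub>v row Y i) \<bullet> (Y *\<^sub>v row Y i)"
    using scalar_prod_self[OF mult_mat_vec_carrier[OF Y(1) w]] by simp
  also have "\<dots> \<le> c^2 * R" using Y w unfolding R by (auto simp: norm_bounded_def)
  finally have "R * R \<le> c^2 * R" by (simp add: power2_eq_square)
  moreover have "R \<ge> 0" by (simp add: R_def sum_nonneg)
  ultimately show ?thesis
    unfolding R_def[symmetric] by (cases "R = 0") auto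
qed

lemma norm_bounded_entry:
  assumes Y: "Y \<in> carrier_mat n1 n2" "norm_bounded c Y" and i: "i < n1" and j: "j < n2"
  shows "\<bar>Y $$ (i,j)\<bar> \<le> c"
proof -
  have "(Y $$ (i,j))^2 \<le> (\<Sum>i<n1. (Y $$ (i,j))^2)" using i by (intro member_le_sum) auto
  also have "\<dots> \<le> c^2" by (rule norm_bounded_col[OF Y j])
  finally show ?thesis using Y(2) abs_le_square_iff[of "Y $$ (i,j)" c] by (simp add: norm_bounded_def)
qed

lemma mat_inner_diag:
  assumes S: "S \<in> carrier_mat n1 n2" and diag: "\<And>i j. i < n1 \<Longrightarrow> j < n2 \<Longrightarrow> i \<noteq> j \<Longrightarrow> S $$ (i,j) = 0"
  shows "mat_inner S Y = (\<Sum>i<min n1 n2. S $$ (i,i) * Y $$ (i,i))"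
proof -
  have "mat_inner S Y = (\<Sum>i<n1. \<Sum>j<n2. if j = i then S $$ (i,i) * Y $$ (i,i) else 0)"
    unfolding mat_inner_def using S diag by (intro sum.cong) auto
  also have "\<dots> = (\<Sum>i<n1. if i < n2 then S $$ (i,i) * Y $$ (i,i) else 0)" by simp
  also have "\<dots> = (\<Sum>i<min n1 n2. S $$ (i,i) * Y $$ (i,i))"
    by (rule sum.mono_neutral_cong_right) auto
  finally show ?thesis .
qed

text \<open>The upper half of the duality. In the coordinates of a decomposition of
  \<open>A\<close>, only the diagonal of the transformed \<open>Z\<close> meets \<open>S\<close>,
  and its entries are bounded by \<open>c\<close> because orthogonal factors preserve the operator
  bound.\<close>

lemma abs_mat_inner_le_nuc_norm:
  assumes A: "A \<in> carrier_mat n1 n2" and Z: "Z \<in> carrier_mat n1 n2" "norm_bounded c Z"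
  shows "\<bar>mat_inner A Z\<bar> \<le> c * nuc_norm A"
proof -
  obtain U S V where svd: "is_svd A U S V" using svd_exists by blast
  have U: "U \<in> carrier_mat n1 n1" "transpose_mat U * U = 1\<^sub>m n1"
    and V: "V \<in> carrier_mat n2 n2" "transpose_mat V * V = 1\<^sub>m n2" and S: "S \<in> carrier_mat n1 n2"
    and Aeq: "A = U * S * transpose_mat V"
    and diag: "\<And>i j. i < n1 \<Longrightarrow> j < n2 \<Longrightarrow> i \<noteq> j \<Longrightarrow> S $$ (i,j) = 0"
    and nonneg: "\<And>i. i < min n1 n2 \<Longrightarrow> 0 \<le> S $$ (i,i)"
    using is_svdD[OF svd A] by blast+
  define Y where "Y = transpose_mat U * Z * V"
  have Y: "Y \<in> carrier_mat n1 n2" using U V Z by (simp add: Y_def)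
  have "norm_bounded 1 (transpose_mat U)"
    using U orthogonal_mat_comm[OF U] by (intro norm_bounded_orthogonal[of _ n1]) auto
  then have "norm_bounded (1 * c) (transpose_mat U * Z)"
    by (intro norm_bounded_mult[OF _ _ Z]) (use U in auto)
  then have "norm_bounded (1 * c * 1) Y"
    unfolding Y_def using norm_bounded_mult[OF _ _ V(1) norm_bounded_orthogonal[OF V], of "transpose_mat U * Z" n1 "1 * c"] U Z by auto
  then have Yb: "norm_bounded c Y" by simp
  have "mat_inner A Z = mat_inner S Y"
    unfolding Aeq Y_def by (rule mat_inner_sandwich[OF U(1) V(1) S Z(1)])
  also have "\<dots> = (\<Sum>i<min n1 n2. S $$ (i,i) * Y $$ (i,i))" by (rule mat_inner_diag[OF S diag])
  finally have "\<bar>mat_inner A Z\<bar> \<le> (\<Sum>i<min n1 n2. \<bar>S $$ (i,i) * Y $$ (i,i)\<bar>)"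
    using sum_abs by simp
  also have "\<dots> \<le> (\<Sum>i<min n1 n2. c * S $$ (i,i))"
  proof (rule sum_mono)
    fix i assume "i \<in> {..<min n1 n2}"
    then show "\<bar>S $$ (i,i) * Y $$ (i,i)\<bar> \<le> c * S $$ (i,i)"
      using nonneg[of i] norm_bounded_entry[OF Y Yb, of i i]
      by (simp add: abs_mult mult.commute[of c] mult_left_mono)
  qed
  also have "\<dots> = c * nuc_norm A" using nuc_norm_eq[OF svd] A by (simp add: sum_distrib_left)
  finally show ?thesis .
qed

text \<open>The other half of the duality: replacing \<open>S\<close> in the decomposition by the
  rectangular identity \<open>E\<close> gives a contraction that picks up every singular value with
  weight 1.\<close>

lemma nuc_norm_attained:
  assumes A: "A \<in> carrier_mat n1 n2"
  shows "\<exists>W \<in> carrier_mat n1 n2. norm_bounded 1 W \<and> mat_inner A W = nuc_norm A"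
proof -
  obtain U S V where svd: "is_svd A U S V" using svd_exists by blast
  have U: "U \<in> carrier_mat n1 n1" "transpose_mat U * U = 1\<^sub>m n1"
    and V: "V \<in> carrier_mat n2 n2" "transpose_mat V * V = 1\<^sub>m n2" and S: "S \<in> carrier_mat n1 n2"
    and Aeq: "A = U * S * transpose_mat V"
    and diag: "\<And>i j. i < n1 \<Longrightarrow> j < n2 \<Longrightarrow> i \<noteq> j \<Longrightarrow> S $$ (i,j) = 0"
    using is_svdD[OF svd A] by blast+
  define E :: "real mat" where "E = mat n1 n2 (\<lambda>(i,j). if i = j then 1 else 0)"
  have E: "E \<in> carrier_mat n1 n2" by (simp add: E_def)
  have Eb: "norm_bounded 1 E" by (rule norm_bounded_diag[of _ n1 n2]) (auto simp: E_def)
  let ?W = "U * E * transpose_mat V"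
  have W: "?W \<in> carrier_mat n1 n2" using U V E by auto
  have "norm_bounded 1 (transpose_mat V)"
    using V orthogonal_mat_comm[OF V] by (intro norm_bounded_orthogonal[of _ n2]) auto
  moreover have "norm_bounded (1 * 1) (U * E)"
    by (rule norm_bounded_mult[OF U(1) norm_bounded_orthogonal[OF U] E Eb])
  ultimately have "norm_bounded (1 * 1 * 1) ?W"
    using norm_bounded_mult[OF mult_carrier_mat[OF U(1) E], of "1 * 1" "transpose_mat V" n2 1] V by auto
  moreover have "mat_inner A ?W = nuc_norm A"
  proof -
    have "mat_inner A ?W = mat_inner S (transpose_mat U * ?W * V)"
      unfolding Aeq by (rule mat_inner_sandwich[OF U(1) V(1) S W])
    also have "\<dots> = mat_inner S E" unfolding orthogonal_sandwich_cancel[OF U V E] ..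
    also have "\<dots> = (\<Sum>i<min n1 n2. S $$ (i,i) * E $$ (i,i))" by (rule mat_inner_diag[OF S diag])
    also have "\<dots> = (\<Sum>i<min n1 n2. S $$ (i,i))" by (rule sum.cong) (auto simp: E_def)
    also have "\<dots> = nuc_norm A" using nuc_norm_eq[OF svd] A by simp
    finally show ?thesis .
  qed
  ultimately show ?thesis using W by auto
qed

text \<open>By duality, a contraction that is optimal for the sum also gives lower bounds for the
  nuclear norms of both summands.\<close>

lemma nuc_norm_triangle:
  assumes "A \<in> carrier_mat n1 n2" "B \<in> carrier_mat n1 n2"
  shows "nuc_norm (A + B) \<le> nuc_norm A + nuc_norm B"
proof -
  obtain W where W: "W \<in> carrier_mat n1 n2" "norm_bounded 1 W" "mat_inner (A + B) W = nuc_norm (A + B)"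
    using nuc_norm_attained[of "A + B" n1 n2] assms by auto
  then show ?thesis
    using abs_mat_inner_le_nuc_norm[OF assms(1) W(1,2)] abs_mat_inner_le_nuc_norm[OF assms(2) W(1,2)]
      mat_inner_add_left[OF assms, of W] by linarith
qed

lemma nuc_norm_nonneg:
  assumes "A \<in> carrier_mat n1 n2"
  shows "0 \<le> nuc_norm A"
  using nuc_norm_attained[OF assms] abs_mat_inner_le_nuc_norm[OF assms] by fastforce

section \<open>The error of the augmented model\<close>

text \<open>An optimal contraction \<open>W\<close> matters only on the first \<open>r\<close> rows
  and columns. Each of these has length at most 1, so the restriction \<open>M\<close> has squared
  Frobenius norm at most \<open>2 * r\<close>, and the Cauchy-Schwarz inequality applies.\<close>

lemma nuc_norm_le_fro_norm_of_zero_block: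
  assumes A: "A \<in> carrier_mat n1 n2"
    and zero: "\<And>i j. i < n1 \<Longrightarrow> j < n2 \<Longrightarrow> r \<le> i \<Longrightarrow> r \<le> j \<Longrightarrow> A $$ (i,j) = 0"
  shows "nuc_norm A \<le> sqrt (2 * real r) * fro_norm A"
proof -
  obtain W where W: "W \<in> carrier_mat n1 n2" "norm_bounded 1 W" "mat_inner A W = nuc_norm A"
    using nuc_norm_attained[OF A] by blast
  define M where "M i j = (if i < r \<or> j < r then W $$ (i,j) else 0)" for i j
  let ?I = "{..<n1} \<times> {..<n2}"
  have count: "(\<Sum>i<n. if i < r then f i else 0) \<le> real r" if "\<And>i. i < n \<Longrightarrow> f i \<le> 1" for n and f :: "nat \<Rightarrow> real"
  proof -
    have "(\<Sum>i<n. if i < r then f i else 0) = (\<Sum>i<min n r. f i)"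
      by (rule sum.mono_neutral_cong_right) auto
    also have "\<dots> \<le> real (card {..<min n r}) * 1" using that by (intro sum_bounded_above) auto
    finally show ?thesis by simp
  qed
  have "(\<Sum>(i,j)\<in>?I. (M i j)^2) = (\<Sum>i<n1. \<Sum>j<n2. (M i j)^2)"
    by (simp add: sum.cartesian_product)
  \<comment> \<open>Counting the leading \<open>r\<close> by \<open>r\<close> block twice separates
    the row bound from the column bound.\<close>
  also have "\<dots> \<le> (\<Sum>i<n1. \<Sum>j<n2. (if i < r then (W $$ (i,j))^2 else 0) + (if j < r then (W $$ (i,j))^2 else 0))"
    by (intro sum_mono) (auto simp: M_def)
  also have "\<dots> = (\<Sum>i<n1. if i < r then (\<Sum>j<n2. (W $$ (i,j))^2) else 0)
      + (\<Sum>i<n1. \<Sum>j<n2. if j < r then (W $$ (i,j))^2 else 0)"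
    unfolding sum.distrib by (intro arg_cong2[where f = "(+)"] sum.cong) auto
  also have "(\<Sum>i<n1. \<Sum>j<n2. if j < r then (W $$ (i,j))^2 else 0)
      = (\<Sum>j<n2. if j < r then (\<Sum>i<n1. (W $$ (i,j))^2) else 0)"
    by (subst sum.swap) (intro sum.cong, auto)
  also have "(\<Sum>i<n1. if i < r then (\<Sum>j<n2. (W $$ (i,j))^2) else 0) +
      (\<Sum>j<n2. if j < r then (\<Sum>i<n1. (W $$ (i,j))^2) else 0) \<le> real r + real r"
    using norm_bounded_row[OF W(1,2)] norm_bounded_col[OF W(1,2)] by (intro add_mono count) auto
  finally have M2: "(\<Sum>(i,j)\<in>?I. (M i j)^2) \<le> 2 * real r" by simp
  have A2: "(fro_norm A)^2 = (\<Sum>(i,j)\<in>?I. (A $$ (i,j))^2)"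
    unfolding fro_norm_sq mat_inner_def sum.cartesian_product using A by (simp add: power2_eq_square)
  have "nuc_norm A = (\<Sum>i<n1. \<Sum>j<n2. A $$ (i,j) * M i j)"
    unfolding W(3)[symmetric] mat_inner_def using A zero by (intro sum.cong) (auto simp: M_def)
  also have "\<dots> = (\<Sum>(i,j)\<in>?I. A $$ (i,j) * M i j)" by (simp add: sum.cartesian_product)
  finally have "(nuc_norm A)^2 \<le> (\<Sum>(i,j)\<in>?I. (A $$ (i,j))^2) * (\<Sum>(i,j)\<in>?I. (M i j)^2)"
    using Cauchy_Schwarz_ineq_sum[of "\<lambda>(i,j). A $$ (i,j)" "\<lambda>(i,j). M i j" ?I]
    by (simp add: case_prod_unfold)
  also have "\<dots> \<le> (fro_norm A)^2 * (2 * real r)"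
    unfolding A2[symmetric] using M2 by (intro mult_left_mono) auto
  also have "\<dots> = (sqrt (2 * real r) * fro_norm A)^2" by (simp add: power_mult_distrib)
  finally show ?thesis by (rule power2_le_imp_le) (simp add: fro_norm_nonneg)
qed

text \<open>The matrix is block diagonal. It copies leading entries of \<open>x\<close> and applies
  \<open>Y\<close> to the vector \<open>y\<close> of trailing entries, so the two squared lengths
  add up to at most that of \<open>x\<close>.\<close>

lemma norm_bounded_identity_block:
  assumes Y: "Y \<in> carrier_mat n1 n2" "norm_bounded 1 Y"
  shows "norm_bounded 1 (mat n1 n2 (\<lambda>(i,j). if i < r \<or> j < r then (if i = j then 1 else 0) else Y $$ (i,j)))"
    (is "norm_bounded 1 ?W")
  unfolding norm_bounded_def
proof (intro conjI ballI)
  fix x :: "real vec" assume "x \<in> carrier_vec (dim_col ?W)"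
  then have x: "x \<in> carrier_vec n2" by simp
  define y where "y = vec n2 (\<lambda>j. if j < r then 0 else x $ j)"
  have y: "y \<in> carrier_vec n2" by (simp add: y_def)
  have top: "(?W *\<^sub>v x) $ i = (if i < n2 then x $ i else 0)" if "i < n1" "i < r" for i
  proof -
    have "(?W *\<^sub>v x) $ i = (\<Sum>j<n2. (if i = j then 1 else 0) * x $ j)"
      using that x by (simp add: scalar_prod_def lessThan_atLeast0)
    also have "\<dots> = (\<Sum>j<n2. if j = i then x $ i else 0)" by (rule sum.cong) auto
    finally show ?thesis by simp
  qed
  have bot: "(?W *\<^sub>v x) $ i = (Y *\<^sub>v y) $ i" if "i < n1" "\<not> i < r" for i
  proof -
    have "(?W *\<^sub>v x) $ i = (\<Sum>j<n2. (if j < r then (if i = j then 1 else 0) else Y $$ (i,j)) * x $ j)"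
      using that x by (simp add: scalar_prod_def lessThan_atLeast0)
    also have "\<dots> = (\<Sum>j<n2. Y $$ (i,j) * y $ j)" using that by (intro sum.cong) (auto simp: y_def)
    also have "\<dots> = (Y *\<^sub>v y) $ i" using that y Y by (simp add: scalar_prod_def lessThan_atLeast0)
    finally show ?thesis .
  qed
  have Wx: "?W *\<^sub>v x \<in> carrier_vec n1" by (rule mult_mat_vec_carrier[OF _ x]) simp
  have Yy: "Y *\<^sub>v y \<in> carrier_vec n1" using Y y by auto
  have "(?W *\<^sub>v x) \<bullet> (?W *\<^sub>v x) = (\<Sum>i<n1. ((?W *\<^sub>v x) $ i)^2)" by (rule scalar_prod_self[OF Wx])
  also have "\<dots> \<le> (\<Sum>i<n1. (if i < n2 \<and> i < r then (x $ i)^2 else 0) + ((Y *\<^sub>v y) $ i)^2)"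
  proof (rule sum_mono)
    fix i assume "i \<in> {..<n1}"
    then have i: "i < n1" by simp
    show "((?W *\<^sub>v x) $ i)^2 \<le> (if i < n2 \<and> i < r then (x $ i)^2 else 0) + ((Y *\<^sub>v y) $ i)^2"
    proof (cases "i < r")
      case True
      then show ?thesis unfolding top[OF i True] by simp
    next
      case False
      then show ?thesis unfolding bot[OF i False] by simp
    qed
  qed
  also have "\<dots> = (\<Sum>i<n1. if i < n2 \<and> i < r then (x $ i)^2 else 0) + (Y *\<^sub>v y) \<bullet> (Y *\<^sub>v y)"
    unfolding scalar_prod_self[OF Yy] sum.distrib ..
  also have "\<dots> \<le> (\<Sum>i<n2. if i < r then (x $ i)^2 else 0) + y \<bullet> y"
  proof (rule add_mono)
    have "(\<Sum>i<n1. if i < n2 \<and> i < r then (x $ i)^2 else 0) = (\<Sum>i<min n1 n2. if i < r then (x $ i)^2 else 0)"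
      by (rule sum.mono_neutral_cong_right) auto
    also have "\<dots> \<le> (\<Sum>i<n2. if i < r then (x $ i)^2 else 0)" by (rule sum_mono2) auto
    finally show "(\<Sum>i<n1. if i < n2 \<and> i < r then (x $ i)^2 else 0) \<le> (\<Sum>i<n2. if i < r then (x $ i)^2 else 0)" .
    show "(Y *\<^sub>v y) \<bullet> (Y *\<^sub>v y) \<le> y \<bullet> y" using Y y by (auto simp: norm_bounded_def)
  qed
  also have "\<dots> = x \<bullet> x"
    unfolding scalar_prod_self[OF y] scalar_prod_self[OF x] sum.distrib[symmetric]
    by (rule sum.cong) (auto simp: y_def)
  finally show "(?W *\<^sub>v x) \<bullet> (?W *\<^sub>v x) \<le> 1^2 * (x \<bullet> x)" by simp
qed simp

lemma nuc_norm_diag: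
  assumes S: "S \<in> carrier_mat n1 n2" and diag: "\<And>i j. i < n1 \<Longrightarrow> j < n2 \<Longrightarrow> i \<noteq> j \<Longrightarrow> S $$ (i,j) = 0"
    and nonneg: "\<And>i. i < min n1 n2 \<Longrightarrow> 0 \<le> S $$ (i,i)"
    and mono: "\<And>i j. i \<le> j \<Longrightarrow> j < min n1 n2 \<Longrightarrow> S $$ (j,j) \<le> S $$ (i,i)"
  shows "nuc_norm S = (\<Sum>i<min n1 n2. S $$ (i,i))"
proof -
  have dims: "dim_row S = n1" "dim_col S = n2" using S by auto
  have "S = 1\<^sub>m n1 * S * transpose_mat (1\<^sub>m n2)" using S by simp
  moreover have "transpose_mat (1\<^sub>m n) * 1\<^sub>m n = (1\<^sub>m n :: real mat)" for n by simp
  ultimately have "is_svd S (1\<^sub>m n1) S (1\<^sub>m n2)"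
    unfolding is_svd_def Let_def dims using S diag nonneg mono by (intro conjI) auto
  then show ?thesis using nuc_norm_eq dims by metis
qed

text \<open>The witnesses are the nuclear norms of \<open>G1\<close> and \<open>G2\<close>. The
  bounds \<open>a\<close> and \<open>b\<close> on the whole diagonal and on its tail stand for the
  first and the \<open>(r+1)\<close>-th singular value.\<close>

lemma augmented_diag_cone:
  fixes S G :: "real mat"
  assumes S: "S \<in> carrier_mat n1 n2" and G: "G \<in> carrier_mat n1 n2"
    and diag: "\<And>i j. i < n1 \<Longrightarrow> j < n2 \<Longrightarrow> i \<noteq> j \<Longrightarrow> S $$ (i,j) = 0"
    and nonneg: "\<And>i. i < min n1 n2 \<Longrightarrow> 0 \<le> S $$ (i,i)"
    and mono: "\<And>i j. i \<le> j \<Longrightarrow> j < min n1 n2 \<Longrightarrow> S $$ (j,j) \<le> S $$ (i,i)"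
    and a: "0 \<le> a" "\<And>i. i < min n1 n2 \<Longrightarrow> S $$ (i,i) \<le> a"
    and b: "0 \<le> b" "\<And>i. r \<le> i \<Longrightarrow> i < min n1 n2 \<Longrightarrow> S $$ (i,i) \<le> b"
    and \<alpha>: "\<alpha> > 0" and le: "N2_obj \<alpha> (S + G) \<le> N2_obj \<alpha> S"
  shows "\<exists>x y. nuc_norm G \<le> x + y \<and> x \<le> sqrt (2 * real r) * fro_norm G \<and>
    (\<alpha> - b) * y \<le> (\<alpha> + a) * x + 2 * \<alpha> * (\<Sum>i=r..<min n1 n2. S $$ (i,i))"
proof -
  let ?k = "min n1 n2"
  define G1 where "G1 = mat n1 n2 (\<lambda>(i,j). if i < r \<or> j < r then G $$ (i,j) else 0)"
  define G2 where "G2 = mat n1 n2 (\<lambda>(i,j). if i < r \<or> j < r then 0 else G $$ (i,j))"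
  have G12: "G1 \<in> carrier_mat n1 n2" "G2 \<in> carrier_mat n1 n2" by (auto simp: G1_def G2_def)
  have Geq: "G = G1 + G2" using G by (intro eq_matI) (auto simp: G1_def G2_def)
  have G1fro: "fro_norm G1 \<le> fro_norm G"
    unfolding fro_norm_def using G by (auto simp: G1_def intro!: real_sqrt_le_mono sum_mono)
  have x: "nuc_norm G1 \<le> sqrt (2 * real r) * fro_norm G"
  proof -
    have "nuc_norm G1 \<le> sqrt (2 * real r) * fro_norm G1"
      by (rule nuc_norm_le_fro_norm_of_zero_block[OF G12(1)]) (auto simp: G1_def)
    also have "\<dots> \<le> sqrt (2 * real r) * fro_norm G" using G1fro by (intro mult_left_mono) auto
    finally show ?thesis .
  qed
  obtain Y where Y: "Y \<in> carrier_mat n1 n2" "norm_bounded 1 Y" "mat_inner G2 Y = nuc_norm G2"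
    using nuc_norm_attained[OF G12(2)] by blast
  define W where "W = mat n1 n2 (\<lambda>(i,j). if i < r \<or> j < r then (if i = j then 1 else 0) else Y $$ (i,j))"
  have W: "W \<in> carrier_mat n1 n2" "norm_bounded 1 W"
    using norm_bounded_identity_block[OF Y(1,2)] by (auto simp: W_def)
  let ?t = "\<Sum>i=r..<?k. S $$ (i,i)"
  let ?h = "\<Sum>i\<in>{..<?k} \<inter> {..<r}. S $$ (i,i)"
  have split: "(\<Sum>i<?k. f i) = (\<Sum>i\<in>{..<?k} \<inter> {..<r}. f i) + (\<Sum>i=r..<?k. f i)" for f :: "nat \<Rightarrow> real"
  proof -
    have "{..<?k} = ({..<?k} \<inter> {..<r}) \<union> {r..<?k}" by auto
    then show ?thesis by (metis (no_types, lifting) sum.union_disjoint finite_Int finite_lessThan finite_atLeastLessThan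
      disjoint_iff Int_iff atLeastLessThan_iff lessThan_iff not_le)
  qed
  have nucS: "nuc_norm S = ?h + ?t"
    by (rule trans[OF _ split], rule nuc_norm_diag[OF S diag nonneg mono])
  \<comment> \<open>On the leading diagonal \<open>W\<close> is 1; on the tail its entries are at
    least -1. The gap of \<open>2 * ?t\<close> to \<open>nuc_norm S\<close> is the source of the
    tail term in the conclusion.\<close>
  have "mat_inner S W \<ge> ?h - ?t"
  proof -
    have 1: "mat_inner S W = (\<Sum>i\<in>{..<?k} \<inter> {..<r}. S $$ (i,i) * W $$ (i,i)) + (\<Sum>i=r..<?k. S $$ (i,i) * W $$ (i,i))"
      by (rule trans[OF _ split], rule mat_inner_diag[OF S diag])
    have 2: "(\<Sum>i\<in>{..<?k} \<inter> {..<r}. S $$ (i,i) * W $$ (i,i)) = ?h"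
      by (rule sum.cong) (auto simp: W_def)
    have "(\<Sum>i=r..<?k. S $$ (i,i) * W $$ (i,i)) \<ge> (\<Sum>i=r..<?k. - S $$ (i,i))"
    proof (rule sum_mono)
      fix i assume "i \<in> {r..<?k}"
      then have "0 \<le> S $$ (i,i)" "\<bar>W $$ (i,i)\<bar> \<le> 1"
        using nonneg[of i] norm_bounded_entry[OF W, of i i] by auto
      then have "S $$ (i,i) * (- 1) \<le> S $$ (i,i) * W $$ (i,i)" by (intro mult_left_mono) auto
      then show "- S $$ (i,i) \<le> S $$ (i,i) * W $$ (i,i)" by simp
    qed
    then show ?thesis using 1 2 by (simp add: sum_negf)
  qed
  moreover have "mat_inner G2 W = nuc_norm G2"
    unfolding Y(3)[symmetric] mat_inner_def by (intro sum.cong) (auto simp: G2_def W_def)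
  moreover have "\<bar>mat_inner G1 W\<bar> \<le> nuc_norm G1"
    using abs_mat_inner_le_nuc_norm[OF G12(1) W] by simp
  moreover have "mat_inner (S + G) W = mat_inner S W + (mat_inner G1 W + mat_inner G2 W)"
    unfolding mat_inner_add_left[OF S G] unfolding Geq mat_inner_add_left[OF G12] ..
  moreover have "mat_inner (S + G) W \<le> nuc_norm (S + G)"
    using abs_mat_inner_le_nuc_norm[of "S + G" n1 n2 W 1] S G W by auto
  ultimately have nucSG: "nuc_norm (S + G) \<ge> ?h - ?t - nuc_norm G1 + nuc_norm G2" by linarith
  define q where "q = - a * nuc_norm G1 - b * nuc_norm G2"
  \<comment> \<open>\<open>G1\<close> is paired with all of \<open>S\<close>, whose operator norm is
    at most \<open>a\<close>. \<open>G2\<close> sees only the trailing block \<open>T\<close>, whose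
    operator norm is at most \<open>b\<close>; this gives the smaller weight on
    \<open>G2\<close>.\<close>
  have "mat_inner S G \<ge> q"
  proof -
    have "norm_bounded a S" using a nonneg by (intro norm_bounded_diag[OF S diag]) auto
    then have 1: "\<bar>mat_inner G1 S\<bar> \<le> a * nuc_norm G1" by (rule abs_mat_inner_le_nuc_norm[OF G12(1) S])
    define T where "T = mat n1 n2 (\<lambda>(i,j). if i < r \<or> j < r then 0 else S $$ (i,j))"
    have T: "T \<in> carrier_mat n1 n2" by (simp add: T_def)
    have "norm_bounded b T" using b nonneg diag by (intro norm_bounded_diag[OF T]) (auto simp: T_def)
    then have "\<bar>mat_inner G2 T\<bar> \<le> b * nuc_norm G2" by (rule abs_mat_inner_le_nuc_norm[OF G12(2) T])
    moreover have "mat_inner G2 T = mat_inner G2 S"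
      unfolding mat_inner_def by (intro sum.cong) (auto simp: G2_def T_def)
    moreover have "mat_inner S G = mat_inner G1 S + mat_inner G2 S"
      unfolding mat_inner_commute[OF S G] unfolding Geq by (rule mat_inner_add_left[OF G12])
    ultimately show ?thesis using 1 by (simp add: q_def)
  qed
  moreover have "(fro_norm (S + G))^2 = (fro_norm S)^2 + 2 * mat_inner S G + (fro_norm G)^2"
    unfolding fro_norm_sq mat_inner_add_left[OF S G]
    unfolding mat_inner_add_right[OF S G S] mat_inner_add_right[OF S G G] mat_inner_commute[OF G S] by simp
  \<comment> \<open>The square of \<open>fro_norm G\<close> is nonnegative and is dropped.\<close>
  ultimately have fro: "(fro_norm (S + G))^2 \<ge> (fro_norm S)^2 + 2 * q"
    by (simp add: add_increasing2)
  have "2 * \<alpha> * nuc_norm (S + G) + (fro_norm (S + G))^2 \<le> 2 * \<alpha> * nuc_norm S + (fro_norm S)^2"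
  proof -
    have "2 * \<alpha> * nuc_norm X + (fro_norm X)^2 = 2 * \<alpha> * N2_obj \<alpha> X" for X
      using \<alpha> by (simp add: N2_obj_def field_simps)
    then show ?thesis using le \<alpha> by simp
  qed
  moreover have "2 * \<alpha> * (?h - ?t - nuc_norm G1 + nuc_norm G2) \<le> 2 * \<alpha> * nuc_norm (S + G)"
    using nucSG \<alpha> by (intro mult_left_mono) auto
  ultimately have "2 * \<alpha> * (?h - ?t - nuc_norm G1 + nuc_norm G2) + 2 * q
      \<le> 2 * \<alpha> * (?h + ?t)"
    using fro nucS by simp
  \<comment> \<open>The terms with \<open>?h\<close> cancel and the whole inequality is halved, so
    \<open>4 * \<alpha> * ?t\<close> becomes \<open>2 * \<alpha> * ?t\<close>.\<close>
  then have "(\<alpha> - b) * nuc_norm G2 \<le> (\<alpha> + a) * nuc_norm G1 + 2 * \<alpha> * ?t"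
    by (simp add: q_def algebra_simps)
  moreover have "nuc_norm G \<le> nuc_norm G1 + nuc_norm G2" unfolding Geq by (rule nuc_norm_triangle[OF G12])
  ultimately show ?thesis using x by blast
qed

section \<open>Reduction to diagonal form and the final estimate\<close>

theorem mainTheorem13:
  fixes n1 n2 m r :: nat and \<A> :: "real mat \<Rightarrow> real vec"
    and \<Delta> \<alpha> C3 C4 :: real and X0 Xs :: "real mat"
  assumes lin: "lin_meas n1 n2 m \<A>"
    and Delta_pos: "\<Delta> > 0"
    and nsp: "\<forall>H\<in>null_space n1 n2 m \<A>. H \<noteq> 0\<^sub>m n1 n2 \<longrightarrow>
                 nuc_norm H \<ge> sqrt (real m / \<Delta>) * fro_norm H"
    and X0: "X0 \<in> carrier_mat n1 n2"
    and alpha: "\<alpha> > sing_val X0 (r + 1)"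
    and C3: "C3 = (\<alpha> + sing_val X0 1) / (\<alpha> - sing_val X0 (r + 1))"
    and C4: "C4 = 2 * \<alpha> / (\<alpha> - sing_val X0 (r + 1))"
    and m_bound: "real m \<ge> 4 * (1 + C3)^2 * real r * \<Delta>"
    and sol: "is_N2_solution n1 n2 \<A> (\<A> X0) \<alpha> Xs"
  shows "nuc_norm (Xs - X0) \<le> 4 * C4 * (\<Sum>i=r+1..min n1 n2. sing_val X0 i)"
proof -
  obtain U S V where svd: "is_svd X0 U S V" using svd_exists by blast
  note svdD = is_svdD[OF svd X0]
  have U: "U \<in> carrier_mat n1 n1" "transpose_mat U * U = 1\<^sub>m n1"
    and V: "V \<in> carrier_mat n2 n2" "transpose_mat V * V = 1\<^sub>m n2" and S: "S \<in> carrier_mat n1 n2"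
    and X0eq: "X0 = U * S * transpose_mat V"
    using svdD by blast+
  have dims: "dim_row X0 = n1" "dim_col X0 = n2" using X0 by auto
  have sv: "sing_val X0 i = (if 1 \<le> i \<and> i \<le> min n1 n2 then S $$ (i-1, i-1) else 0)" for i
    using sing_val_eq[OF svd, of i] unfolding dims .
  have tail: "(\<Sum>i=r+1..min n1 n2. sing_val X0 i) = (\<Sum>i=r..<min n1 n2. S $$ (i,i))" (is "_ = ?t")
    using sum_sing_val_eq[OF svd, of r] unfolding dims .
  let ?a = "sing_val X0 1" and ?b = "sing_val X0 (r + 1)"
  \<comment> \<open>If \<open>r \<ge> min n1 n2\<close>, then \<open>?b\<close> is the default value
    0, so no case distinction on \<open>r\<close> is required. Positivity of \<open>\<alpha>\<close>
    then follows from \<open>alpha\<close>.\<close>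
  have a0: "0 \<le> ?a" and b0: "0 \<le> ?b" using sv[of 1] sv[of "r + 1"] svdD(7) by auto
  have a: "S $$ (i,i) \<le> ?a" if "i < min n1 n2" for i using sv[of 1] svdD(8)[of 0 i] that by auto
  have b: "S $$ (i,i) \<le> ?b" if "r \<le> i" "i < min n1 n2" for i using sv[of "r + 1"] svdD(8)[of r i] that by auto
  have \<alpha>: "\<alpha> > 0" using alpha b0 by linarith

  have Xs: "Xs \<in> carrier_mat n1 n2" "\<A> Xs = \<A> X0" and opt: "N2_obj \<alpha> Xs \<le> N2_obj \<alpha> X0"
    using sol X0 by (auto simp: is_N2_solution_def)
  define H where "H = Xs - X0"
  have H: "H \<in> carrier_mat n1 n2" using minus_carrier_mat[OF X0] by (simp add: H_def)
  have XsH: "Xs = X0 + H" using Xs X0 by (intro eq_matI) (auto simp: H_def)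
  have "\<A> Xs = \<A> X0 + \<A> H" unfolding XsH using lin X0 H by (simp add: lin_meas_def)
  moreover have c: "\<A> X0 \<in> carrier_vec m" "\<A> H \<in> carrier_vec m" using lin X0 H by (auto simp: lin_meas_def)
  ultimately have "\<A> X0 = \<A> X0 + \<A> H" using Xs by simp
  then have eq: "\<A> X0 $ i = (\<A> X0 + \<A> H) $ i" for i by (rule arg_cong)
  have "\<A> H $ i = 0" if "i < m" for i using eq[of i] c that by simp
  then have "\<A> H = 0\<^sub>v m" using c by (intro eq_vecI) auto
  then have "H \<in> null_space n1 n2 m \<A>" using H by (simp add: null_space_def)
  moreover have "fro_norm (0\<^sub>m n1 n2) = 0" by (simp add: fro_norm_def)
  \<comment> \<open>For \<open>H = 0\<^sub>m n1 n2\<close> the left side vanishes, so the inequality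
    extends to the case excluded in \<open>nsp\<close>.\<close>
  ultimately have Hnsp: "sqrt (real m / \<Delta>) * fro_norm H \<le> nuc_norm H"
    using nsp nuc_norm_nonneg[OF H] by (cases "H = 0\<^sub>m n1 n2") auto

  \<comment> \<open>The error in the coordinates in which \<open>X0\<close> becomes
    \<open>S\<close>; the objective depends only on two orthogonally invariant norms, so optimality
    transfers.\<close>
  define G where "G = transpose_mat U * H * V"
  have G: "G \<in> carrier_mat n1 n2" using U V H by (simp add: G_def)
  have HG: "H = U * G * transpose_mat V"
    unfolding G_def using orthogonal_sandwich_recover[OF H U V] by (rule sym)
  have SG: "S + G \<in> carrier_mat n1 n2" using S G by simp
  have "Xs = U * (S + G) * transpose_mat V"
    unfolding XsH HG X0eq using U V S G
    by (simp add: mult_add_distrib_mat[of _ n1 n1 _ n2] add_mult_distrib_mat[of _ n1 n2 _ _ n2])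
  then have "nuc_norm Xs = nuc_norm (S + G)" "fro_norm Xs = fro_norm (S + G)"
    using nuc_norm_orthogonal[OF U V SG] fro_norm_orthogonal[OF U V SG] by metis+
  moreover have "nuc_norm X0 = nuc_norm S" "fro_norm X0 = fro_norm S"
    using nuc_norm_orthogonal[OF U V S] fro_norm_orthogonal[OF U V S] unfolding X0eq by auto
  ultimately have "N2_obj \<alpha> (S + G) \<le> N2_obj \<alpha> S" using opt by (simp add: N2_obj_def)
  then have "\<exists>x y. nuc_norm G \<le> x + y \<and> x \<le> sqrt (2 * real r) * fro_norm G \<and>
    (\<alpha> - ?b) * y \<le> (\<alpha> + ?a) * x + 2 * \<alpha> * ?t"
    by (rule augmented_diag_cone[OF S G svdD(6,7,8) a0 a b0 b \<alpha>, rotated -1])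
  then obtain x y where xy: "nuc_norm G \<le> x + y" "x \<le> sqrt (2 * real r) * fro_norm G"
    "(\<alpha> - ?b) * y \<le> (\<alpha> + ?a) * x + 2 * \<alpha> * ?t" by blast
  have nucHG: "nuc_norm H = nuc_norm G" "fro_norm H = fro_norm G"
    using nuc_norm_orthogonal[OF U V G] fro_norm_orthogonal[OF U V G] unfolding HG by auto

  have pos: "\<alpha> - ?b > 0" using alpha by simp
  \<comment> \<open>Dividing the cone inequality by \<open>\<alpha> - ?b\<close> produces exactly
    the constants \<open>C3\<close> and \<open>C4\<close>.\<close>
  have "y \<le> ((\<alpha> + ?a) * x + 2 * \<alpha> * ?t) / (\<alpha> - ?b)"
    using xy(3) pos by (simp add: pos_le_divide_eq mult.commute)
  also have "\<dots> = C3 * x + C4 * ?t" unfolding C3 C4 by (subst add_divide_distrib) simp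
  finally have "nuc_norm G \<le> (1 + C3) * x + C4 * ?t" using xy(1) by (simp add: algebra_simps)
  moreover have C3pos: "C3 \<ge> 0" using C3 pos \<alpha> a0 by simp
  have "(1 + C3) * x \<le> 3 / 4 * nuc_norm G"
  proof -
    \<comment> \<open>The factor 4/3 is the reciprocal of the target 3/4. Its square times the 2
      under the root is 32/9, which lies below the constant 4 of \<open>m_bound\<close>.\<close>
    have "(4/3 * (1 + C3) * sqrt (2 * real r))^2 \<le> real m / \<Delta>"
    proof -
      have "(4/3 * (1 + C3) * sqrt (2 * real r))^2 = 32/9 * ((1 + C3)^2 * real r)"
        unfolding power_mult_distrib by (simp add: power_divide)
      also have "\<dots> \<le> 4 * ((1 + C3)^2 * real r)" by (intro mult_right_mono) auto
      also have "\<dots> \<le> real m / \<Delta>" using m_bound Delta_pos by (simp add: field_simps)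
      finally show ?thesis .
    qed
    then have "4/3 * (1 + C3) * sqrt (2 * real r) \<le> sqrt (real m / \<Delta>)" by (rule real_le_rsqrt)
    then have "4/3 * (1 + C3) * sqrt (2 * real r) * fro_norm G \<le> sqrt (real m / \<Delta>) * fro_norm G"
      by (intro mult_right_mono fro_norm_nonneg)
    also have "\<dots> \<le> nuc_norm G" using Hnsp nucHG by simp
    finally have "(1 + C3) * (sqrt (2 * real r) * fro_norm G) \<le> 3 / 4 * nuc_norm G" by (simp add: algebra_simps)
    moreover have "(1 + C3) * x \<le> (1 + C3) * (sqrt (2 * real r) * fro_norm G)"
      using xy(2) C3pos by (intro mult_left_mono) auto
    ultimately show ?thesis by linarith
  qed
  \<comment> \<open>Absorbing three quarters of \<open>nuc_norm G\<close> leaves one quarter,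
    bounded by \<open>C4 * ?t\<close>; hence the factor 4.\<close>
  ultimately have "nuc_norm G \<le> 4 * (C4 * ?t)" by linarith
  then show ?thesis unfolding tail using nucHG by (simp add: H_def)
qed

end
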